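(* Let $k,n,m\geq 2$ be integers with $n<m$ and $n,m$ coprime, and let $G=J\begin{pmatrix} k & n & m\\ & & \end{pmatrix}$. Let $c=(x_1x_2\cdots x_n)^m\in W(k,n,m)$. (1) The map $\varphi:\overline{W(k,n,m)}\to W_{k,n,m}^+$ is an isomorphism. (2) There is a commutative diagram whose rows are the short exact sequences $$1\longrightarrow\langle stu\rangle\longrightarrow G\longrightarrow W_{k,n,m}^+\longrightarrow 1,\qquad 1\longrightarrow\langle c\rangle\longrightarrow W(k,n,m)\longrightarrow W_{k,n,m}^+\longrightarrow 1,$$ and whose vertical maps from the second row to the first row are the inclusions $\langle c\rangle\hookrightarrow\langle stu\rangle$, $W(k,n,m)\hookrightarrow G$, and the identity of $W_{k,n,m}^+$. (3) $Z(W(k,n,m))=\langle c\rangle$ and $Z(G)=\langle stu\rangle$. (4) The homomorphisms $G\to W_{k,n,m}^+$ and $W(k,n,m)\to W_{k,n,m}^+$, together with the inclusion $W(k,n,m)\hookrightarrow G$, induce isomorphisms $$G/Z(G)\cong W(k,n,m)/Z(W(k,n,m))=\overline{W(k,n,m)}\cong W_{k,n,m}^+.$$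
   Context: $G=J\begin{pmatrix} k & n & m\\ & & \end{pmatrix}:=\langle s,t,u\mid s^k=t^n=u^m=1,\ stu=tus=ust\rangle$. Toric reflection group: $W(k,n,m)$ is the group with generators $x_1,\dots,x_n$ and relations $x_i^k=1$ for $i=1,\dots,n$, and $x_1x_2\cdots x_m=x_ix_{i+1}\cdots x_{i+m-1}$ for $i=2,\dots,n$, indices modulo $n$. It is identified with the normal subgroup $J\begin{pmatrix} k & n & m\\ 1 & n & m\end{pmatrix}$ of $G$, i.e., the normal closure of $\{s,t^n,u^m\}=\{s,1,1\}$ in $G$, via the injective homomorphism $x_i\mapsto t^{i-1}st^{1-i}$; this gives the inclusion $W(k,n,m)\hookrightarrow G$. $W_{k,n,m}$ is the Coxeter group $\langle r_1,r_2,r_3\mid r_1^2=r_2^2=r_3^2=1,\ (r_1r_2)^k=(r_2r_3)^n=(r_3r_1)^m=1\rangle$ and $W_{k,n,m}^+$ is its alternating subgroup (the index-two subgroup of elements of even length with respect to $\{r_1,r_2,r_3\}$). The map $G\to W_{k,n,m}^+$ is the homomorphism $s\mapsto r_1r_2$, $t\mapsto r_2r_3$, $u\mapsto r_3r_1$, and $W(k,n,m)\to W_{k,n,m}^+$ is its restriction. The element $c$ is central in $W(k,n,m)$ and is mapped to $1$ by this restriction. $\overline{W(k,n,m)}$ denotes the quotient of $W(k,n,m)$ by the extra relation $c=1$, and $\varphi:\overline{W(k,n,m)}\to W_{k,n,m}^+$ denotes the homomorphism induced by $W(k,n,m)\to W_{k,n,m}^+$. $Z(\cdot)$ denotes the center.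 *)

theory Defs
  imports "HOL-Algebra.Algebra"
begin

section \<open>Groups given by generators and relations\<close>

text \<open>A word is a list of letters; the letter \<open>(x, True)\<close> stands for the generator \<open>x\<close>, and
  \<open>(x, False)\<close> for its formal inverse.  A relation \<open>l = r\<close> is the pair \<open>(l, r)\<close> of words.\<close>

type_synonym 'a word = "('a \<times> bool) list"

definition words :: "'a set \<Rightarrow> 'a word set" where
  "words S = {w. fst ` set w \<subseteq> S}"

definition pos :: "'a list \<Rightarrow> 'a word" where
  "pos xs = map (\<lambda>x. (x, True)) xs"

definition wpow :: "nat \<Rightarrow> 'a word \<Rightarrow> 'a word" where
  "wpow n w = concat (replicate n w)"

definition winv :: "'a word \<Rightarrow> 'a word" where
  "winv w = rev (map (\<lambda>(x, b). (x, \<not> b)) w)"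

text \<open>The congruence on words generated by free cancellation and the relations in \<open>R\<close>.\<close>

inductive_set pres_rel :: "'a set \<Rightarrow> ('a word \<times> 'a word) set \<Rightarrow> ('a word \<times> 'a word) set"
  for S R where
  refl: "w \<in> words S \<Longrightarrow> (w, w) \<in> pres_rel S R"
| sym: "(v, w) \<in> pres_rel S R \<Longrightarrow> (w, v) \<in> pres_rel S R"
| trans: "(u, v) \<in> pres_rel S R \<Longrightarrow> (v, w) \<in> pres_rel S R \<Longrightarrow> (u, w) \<in> pres_rel S R"
| cancel: "x \<in> S \<Longrightarrow> u \<in> words S \<Longrightarrow> v \<in> words S
    \<Longrightarrow> (u @ [(x, b), (x, \<not> b)] @ v, u @ v) \<in> pres_rel S R"
| rel: "(l, r) \<in> R \<Longrightarrow> l \<in> words S \<Longrightarrow> r \<in> words S \<Longrightarrow> u \<in> words S \<Longrightarrow> v \<in> words S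
    \<Longrightarrow> (u @ l @ v, u @ r @ v) \<in> pres_rel S R"

definition pres_class :: "'a set \<Rightarrow> ('a word \<times> 'a word) set \<Rightarrow> 'a word \<Rightarrow> 'a word set" where
  "pres_class S R w = pres_rel S R `` {w}"

definition presented_group :: "'a set \<Rightarrow> ('a word \<times> 'a word) set \<Rightarrow> 'a word set monoid" where
  "presented_group S R =
     \<lparr>carrier = words S // pres_rel S R,
      monoid.mult = (\<lambda>A B. \<Union>a\<in>A. \<Union>b\<in>B. pres_class S R (a @ b)),
      one = pres_class S R []\<rparr>"

fun eval_word :: "('b, 'c) monoid_scheme \<Rightarrow> ('a \<Rightarrow> 'b) \<Rightarrow> 'a word \<Rightarrow> 'b" where
  "eval_word H f [] = \<one>\<^bsub>H\<^esub>"
| "eval_word H f ((x, b) # w) = (if b then f x else inv\<^bsub>H\<^esub> (f x)) \<otimes>\<^bsub>H\<^esub> eval_word H f w"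

text \<open>If \<open>h\<close> is constant on every coset in a quotient group, then \<open>induced_map h\<close> is the map
  that \<open>h\<close> induces on the quotient.  The library phrases the first isomorphism theorem
  (\<open>group_hom.FactGroup_iso_set\<close>) with the same expression.\<close>

definition induced_map :: "('a \<Rightarrow> 'b) \<Rightarrow> 'a set \<Rightarrow> 'b" where
  "induced_map h = (\<lambda>A. the_elem (h ` A))"

text \<open>The homomorphism from a presented group to \<open>H\<close> sending each generator \<open>x\<close> to \<open>f x\<close>;
  meaningful when \<open>f\<close> respects the relations (see \<open>pres_hom\<close> below).\<close>

definition pres_hom :: "('b, 'c) monoid_scheme \<Rightarrow> ('a \<Rightarrow> 'b) \<Rightarrow> 'a word set \<Rightarrow> 'b" where
  "pres_hom H f = induced_map (eval_word H f)"

lemma words_simps [simp]: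
  "[] \<in> words S"
  "a # w \<in> words S \<longleftrightarrow> fst a \<in> S \<and> w \<in> words S"
  "u @ v \<in> words S \<longleftrightarrow> u \<in> words S \<and> v \<in> words S"
  by (auto simp: words_def)

lemma words_winv [simp]: "winv w \<in> words S \<longleftrightarrow> w \<in> words S"
  by (force simp: words_def winv_def)

lemma pres_rel_words: "(v, w) \<in> pres_rel S R \<Longrightarrow> v \<in> words S \<and> w \<in> words S"
  by (induction rule: pres_rel.induct) auto

lemma equiv_pres_rel: "equiv (words S) (pres_rel S R)"
  by (rule equivI)
     (auto simp: refl_on_def sym_def trans_def dest: pres_rel_words
           intro: pres_rel.refl pres_rel.sym pres_rel.trans)

lemma pres_rel_append_context:
  "(v, w) \<in> pres_rel S R \<Longrightarrow> a \<in> words S \<Longrightarrow> b \<in> words S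
    \<Longrightarrow> (a @ v @ b, a @ w @ b) \<in> pres_rel S R"
proof (induction rule: pres_rel.induct)
  case (cancel x u v c)
  then show ?case using pres_rel.cancel[of x S "a @ u" "v @ b" c R] by simp
next
  case (rel l r u v)
  then show ?case using pres_rel.rel[of l r R S "a @ u" "v @ b"] by simp
qed (auto intro: pres_rel.intros)

lemma pres_rel_append:
  assumes "(v, v') \<in> pres_rel S R" "(w, w') \<in> pres_rel S R"
  shows "(v @ w, v' @ w') \<in> pres_rel S R"
  using pres_rel_append_context[OF assms(1), of "[]" w]
    pres_rel_append_context[OF assms(2), of v' "[]"] pres_rel_words[OF assms(1)]
    pres_rel_words[OF assms(2)] by (auto intro: pres_rel.trans)

lemma pres_rel_winv: "w \<in> words S \<Longrightarrow> (winv w @ w, []) \<in> pres_rel S R"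
proof (induction w)
  case Nil
  then show ?case by (simp add: winv_def pres_rel.refl)
next
  case (Cons a w)
  obtain x b where a: "a = (x, b)" by fastforce
  have "(winv w @ [(x, \<not> b), (x, \<not> \<not> b)] @ w, winv w @ w) \<in> pres_rel S R"
    using Cons.prems a by (intro pres_rel.cancel) auto
  with Cons show ?case by (auto simp: a winv_def intro: pres_rel.trans)
qed

lemma pres_class_eq_iff:
  "v \<in> words S \<Longrightarrow> w \<in> words S
    \<Longrightarrow> pres_class S R v = pres_class S R w \<longleftrightarrow> (v, w) \<in> pres_rel S R"
  unfolding pres_class_def by (rule eq_equiv_class_iff[OF equiv_pres_rel])

lemma carrier_presented_group:
  "carrier (presented_group S R) = pres_class S R ` words S"
  by (auto simp: presented_group_def quotient_def pres_class_def)

lemma one_presented_group: "\<one>\<^bsub>presented_group S R\<^esub> = pres_class S R []"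
  by (simp add: presented_group_def)

lemma mult_presented_group:
  assumes "v \<in> words S" "w \<in> words S"
  shows "pres_class S R v \<otimes>\<^bsub>presented_group S R\<^esub> pres_class S R w = pres_class S R (v @ w)"
proof -
  have *: "pres_class S R (a @ b) = pres_class S R (v @ w)"
    if "a \<in> pres_class S R v" "b \<in> pres_class S R w" for a b
  proof -
    have "(v @ w, a @ b) \<in> pres_rel S R"
      using that by (intro pres_rel_append) (auto simp: pres_class_def)
    then show ?thesis using pres_class_eq_iff pres_rel_words by metis
  qed
  have "v \<in> pres_class S R v" "w \<in> pres_class S R w"
    using assms by (auto simp: pres_class_def intro: pres_rel.refl)
  with * have "(\<Union>a\<in>pres_class S R v. \<Union>b\<in>pres_class S R w. pres_class S R (a @ b))
      = pres_class S R (v @ w)"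
    by blast
  then show ?thesis by (simp add: presented_group_def)
qed

lemma group_presented_group: "group (presented_group S R)"
proof (rule groupI)
  fix x y assume "x \<in> carrier (presented_group S R)" "y \<in> carrier (presented_group S R)"
  then obtain v w where "v \<in> words S" "x = pres_class S R v" "w \<in> words S" "y = pres_class S R w"
    unfolding carrier_presented_group by blast
  then show "x \<otimes>\<^bsub>presented_group S R\<^esub> y \<in> carrier (presented_group S R)"
    by (simp add: carrier_presented_group mult_presented_group)
next
  fix x y z
  assume "x \<in> carrier (presented_group S R)" "y \<in> carrier (presented_group S R)"
    "z \<in> carrier (presented_group S R)"
  then obtain u v w where "u \<in> words S" "x = pres_class S R u" "v \<in> words S" "y = pres_class S R v"
    "w \<in> words S" "z = pres_class S R w"
    unfolding carrier_presented_group by blast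
  then show "x \<otimes>\<^bsub>presented_group S R\<^esub> y \<otimes>\<^bsub>presented_group S R\<^esub> z =
      x \<otimes>\<^bsub>presented_group S R\<^esub> (y \<otimes>\<^bsub>presented_group S R\<^esub> z)"
    by (simp add: mult_presented_group)
next
  fix x assume "x \<in> carrier (presented_group S R)"
  then obtain w where w: "w \<in> words S" "x = pres_class S R w"
    unfolding carrier_presented_group by blast
  then show "\<one>\<^bsub>presented_group S R\<^esub> \<otimes>\<^bsub>presented_group S R\<^esub> x = x"
    by (simp add: mult_presented_group one_presented_group)
  have "pres_class S R (winv w) \<otimes>\<^bsub>presented_group S R\<^esub> x = \<one>\<^bsub>presented_group S R\<^esub>"
    using w by (simp add: mult_presented_group one_presented_group pres_class_eq_iff pres_rel_winv)
  moreover have "pres_class S R (winv w) \<in> carrier (presented_group S R)"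
    using w by (simp add: carrier_presented_group)
  ultimately show "\<exists>y\<in>carrier (presented_group S R).
      y \<otimes>\<^bsub>presented_group S R\<^esub> x = \<one>\<^bsub>presented_group S R\<^esub>"
    by blast
qed (simp add: carrier_presented_group one_presented_group)

lemma pres_hom:
  assumes "group H" and f: "\<And>x. x \<in> S \<Longrightarrow> f x \<in> carrier H"
    and R: "\<And>l r. (l, r) \<in> R \<Longrightarrow> eval_word H f l = eval_word H f r"
  shows "pres_hom H f \<in> hom (presented_group S R) H"
    and "\<And>w. w \<in> words S \<Longrightarrow> pres_hom H f (pres_class S R w) = eval_word H f w"
proof -
  interpret group H by fact
  have cl: "eval_word H f w \<in> carrier H" if "w \<in> words S" for w
    using that by (induction w) (auto simp: f)
  have app: "eval_word H f (v @ w) = eval_word H f v \<otimes>\<^bsub>H\<^esub> eval_word H f w"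
    if "v \<in> words S" "w \<in> words S" for v w
    using that by (induction v) (auto simp: f cl m_assoc)
  have inv: "eval_word H f v = eval_word H f w" if "(v, w) \<in> pres_rel S R" for v w
    using that
  proof (induction rule: pres_rel.induct)
    case (cancel x u v b)
    then show ?case by (cases b) (auto simp: app f cl simp flip: m_assoc)
  next
    case (rel l r u v)
    then show ?case by (simp add: app R)
  qed auto
  show ev: "pres_hom H f (pres_class S R w) = eval_word H f w" if "w \<in> words S" for w
  proof -
    have "w \<in> pres_class S R w"
      using that by (simp add: pres_class_def pres_rel.refl)
    moreover have "eval_word H f v = eval_word H f w" if "v \<in> pres_class S R w" for v
      using that inv[of w v] by (simp add: pres_class_def)
    ultimately have "eval_word H f ` pres_class S R w = {eval_word H f w}"
      by blast
    then show ?thesis by (simp add: pres_hom_def induced_map_def)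
  qed
  show "pres_hom H f \<in> hom (presented_group S R) H"
  proof (rule homI)
    fix x assume "x \<in> carrier (presented_group S R)"
    then obtain w where "w \<in> words S" "x = pres_class S R w"
      unfolding carrier_presented_group by blast
    then show "pres_hom H f x \<in> carrier H" by (simp add: ev cl)
  next
    fix x y assume "x \<in> carrier (presented_group S R)" "y \<in> carrier (presented_group S R)"
    then obtain v w where "v \<in> words S" "x = pres_class S R v" "w \<in> words S" "y = pres_class S R w"
      unfolding carrier_presented_group by blast
    then show "pres_hom H f (x \<otimes>\<^bsub>presented_group S R\<^esub> y) = pres_hom H f x \<otimes>\<^bsub>H\<^esub> pres_hom H f y"
      by (simp add: mult_presented_group ev app)
  qed
qed


section \<open>General group-theoretic notions\<close>

definition center :: "('a, 'b) monoid_scheme \<Rightarrow> 'a set" where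
  "center G = {z \<in> carrier G. \<forall>x\<in>carrier G. z \<otimes>\<^bsub>G\<^esub> x = x \<otimes>\<^bsub>G\<^esub> z}"

definition normal_closure :: "('a, 'b) monoid_scheme \<Rightarrow> 'a set \<Rightarrow> 'a set" where
  "normal_closure G A =
     generate G {g \<otimes>\<^bsub>G\<^esub> a \<otimes>\<^bsub>G\<^esub> inv\<^bsub>G\<^esub> g | g a. g \<in> carrier G \<and> a \<in> A}"

text \<open>\<open>1 \<rightarrow> A \<rightarrow> B \<rightarrow> C \<rightarrow> 1\<close> with maps \<open>f\<close> and \<open>g\<close>.  The library's \<open>exact_seq\<close> requires all groups
  to have the same element type, so it does not apply here.\<close>

definition short_exact ::
  "('a, 'x) monoid_scheme \<Rightarrow> ('a \<Rightarrow> 'b) \<Rightarrow> ('b, 'y) monoid_scheme \<Rightarrow> ('b \<Rightarrow> 'c)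
    \<Rightarrow> ('c, 'z) monoid_scheme \<Rightarrow> bool" where
  "short_exact A f B g C \<longleftrightarrow>
     group A \<and> group B \<and> group C \<and> f \<in> mon A B \<and> g \<in> epi B C \<and>
     kernel B C g = f ` carrier A"


section \<open>The groups and maps\<close>

datatype jgen = Gs | Gt | Gu

definition J_gens :: "jgen set" where
  "J_gens = {Gs, Gt, Gu}"

definition J_rels :: "nat \<Rightarrow> nat \<Rightarrow> nat \<Rightarrow> (jgen word \<times> jgen word) set" where
  "J_rels k n m =
     {(wpow k (pos [Gs]), []), (wpow n (pos [Gt]), []), (wpow m (pos [Gu]), []),
      (pos [Gs, Gt, Gu], pos [Gt, Gu, Gs]), (pos [Gt, Gu, Gs], pos [Gu, Gs, Gt])}"

definition J_group :: "nat \<Rightarrow> nat \<Rightarrow> nat \<Rightarrow> jgen word set monoid" where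
  "J_group k n m = presented_group J_gens (J_rels k n m)"

definition J_gen :: "nat \<Rightarrow> nat \<Rightarrow> nat \<Rightarrow> jgen \<Rightarrow> jgen word set" where
  "J_gen k n m x = pres_class J_gens (J_rels k n m) (pos [x])"

definition J_stu :: "nat \<Rightarrow> nat \<Rightarrow> nat \<Rightarrow> jgen word set" where
  "J_stu k n m = pres_class J_gens (J_rels k n m) (pos [Gs, Gt, Gu])"

text \<open>The representative of \<open>i \<ge> 1\<close> modulo \<open>n\<close> in \<open>{1..n}\<close>.\<close>

definition idx :: "nat \<Rightarrow> nat \<Rightarrow> nat" where
  "idx n i = (i - 1) mod n + 1"

definition toric_gens :: "nat \<Rightarrow> nat set" where
  "toric_gens n = {1..n}"

definition toric_rels :: "nat \<Rightarrow> nat \<Rightarrow> nat \<Rightarrow> (nat word \<times> nat word) set" where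
  "toric_rels k n m =
     {(wpow k (pos [i]), []) | i. i \<in> {1..n}} \<union>
     {(pos (map (idx n) [1..<1 + m]), pos (map (idx n) [i..<i + m])) | i. i \<in> {2..n}}"

definition toric_group :: "nat \<Rightarrow> nat \<Rightarrow> nat \<Rightarrow> nat word set monoid" where
  "toric_group k n m = presented_group (toric_gens n) (toric_rels k n m)"

definition toric_c :: "nat \<Rightarrow> nat \<Rightarrow> nat \<Rightarrow> nat word set" where
  "toric_c k n m = pres_class (toric_gens n) (toric_rels k n m) (wpow m (pos [1..<1 + n]))"

definition toric_quot :: "nat \<Rightarrow> nat \<Rightarrow> nat \<Rightarrow> nat word set set monoid" where
  "toric_quot k n m =
     toric_group k n m Mod normal_closure (toric_group k n m) {toric_c k n m}"

datatype cgen = R1 | R2 | R3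

definition cox_gens :: "cgen set" where
  "cox_gens = {R1, R2, R3}"

definition cox_rels :: "nat \<Rightarrow> nat \<Rightarrow> nat \<Rightarrow> (cgen word \<times> cgen word) set" where
  "cox_rels k n m =
     {(wpow 2 (pos [R1]), []), (wpow 2 (pos [R2]), []), (wpow 2 (pos [R3]), []),
      (wpow k (pos [R1, R2]), []), (wpow n (pos [R2, R3]), []), (wpow m (pos [R3, R1]), [])}"

definition cox_group :: "nat \<Rightarrow> nat \<Rightarrow> nat \<Rightarrow> cgen word set monoid" where
  "cox_group k n m = presented_group cox_gens (cox_rels k n m)"

text \<open>An element is a class of words, and its length is that of a shortest word in the class.
  Since the generators are involutions, allowing formal inverses does not change it.\<close>

definition cox_length :: "cgen word set \<Rightarrow> nat" where
  "cox_length g = (LEAST l. \<exists>w\<in>g. length w = l)"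

definition cox_alt :: "nat \<Rightarrow> nat \<Rightarrow> nat \<Rightarrow> cgen word set monoid" where
  "cox_alt k n m = (cox_group k n m)
     \<lparr>carrier := {g \<in> carrier (cox_group k n m). even (cox_length g)}\<rparr>"

fun J_to_alt_gen :: "nat \<Rightarrow> nat \<Rightarrow> nat \<Rightarrow> jgen \<Rightarrow> cgen word set" where
  "J_to_alt_gen k n m Gs = pres_class cox_gens (cox_rels k n m) (pos [R1, R2])"
| "J_to_alt_gen k n m Gt = pres_class cox_gens (cox_rels k n m) (pos [R2, R3])"
| "J_to_alt_gen k n m Gu = pres_class cox_gens (cox_rels k n m) (pos [R3, R1])"

definition J_to_alt :: "nat \<Rightarrow> nat \<Rightarrow> nat \<Rightarrow> jgen word set \<Rightarrow> cgen word set" where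
  "J_to_alt k n m = pres_hom (cox_alt k n m) (J_to_alt_gen k n m)"

text \<open>The inclusion of the toric reflection group: \<open>x\<^sub>i\<close> is sent to the conjugate of \<open>s\<close> by
  the power of \<open>t\<close> with exponent \<open>i - 1\<close>.\<close>

definition toric_incl :: "nat \<Rightarrow> nat \<Rightarrow> nat \<Rightarrow> nat word set \<Rightarrow> jgen word set" where
  "toric_incl k n m = pres_hom (J_group k n m)
     (\<lambda>i. J_gen k n m Gt [^]\<^bsub>J_group k n m\<^esub> (i - 1) \<otimes>\<^bsub>J_group k n m\<^esub> J_gen k n m Gs
           \<otimes>\<^bsub>J_group k n m\<^esub> inv\<^bsub>J_group k n m\<^esub> (J_gen k n m Gt [^]\<^bsub>J_group k n m\<^esub> (i - 1)))"

definition toric_to_alt :: "nat \<Rightarrow> nat \<Rightarrow> nat \<Rightarrow> nat word set \<Rightarrow> cgen word set" where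
  "toric_to_alt k n m = J_to_alt k n m \<circ> toric_incl k n m"

end

theory Submission
  imports Defs Complex_Main
begin

text \<open>
  Write \<open>z = stu\<close>, a central element of \<open>G\<close>, so that \<open>(st)\<^sup>m = z\<^sup>m\<close> and \<open>c\<close> maps to \<open>z\<^sup>n\<^sup>m\<close>.
  In \<open>W = W(k, n, m)\<close> every product \<open>\<delta>\<close> of \<open>m\<close> consecutive generators is the same; conjugation by \<open>\<delta>\<close>
  shifts indices by \<open>m\<close>, and \<open>\<delta>\<^sup>n = c\<close>.  Since \<open>m\<close> is invertible modulo \<open>n\<close>, a power of \<open>\<delta>\<close> shifts
  indices by one, so \<open>t\<close> is the product of this power and a power of \<open>z\<close>.  Hence \<open>G = W \<langle>z\<rangle>\<close>, and sending
  \<open>s\<close>, \<open>t\<close>, \<open>z\<close> to their candidates in \<open>(W \<times> \<int>) / \<langle>(c, - nm)\<rangle>\<close> defines a homomorphism on \<open>G\<close> that is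
  injective on \<open>W\<close> and computes \<open>W \<inter> \<langle>z\<rangle> = \<langle>c\<rangle>\<close>.

  The kernel of \<open>G \<rightarrow> W\<^sup>+\<close> is \<open>\<langle>z\<rangle>\<close> because the Coxeter group acts on \<open>G\<close> modulo \<open>\<langle>z\<rangle>\<close> in such a way that the
  image of \<open>g\<close> acts as left multiplication by \<open>g\<close>.

  The centres are then determined by the fact that \<open>W\<^sup>+\<close> has trivial centre.  In the geometric
  representation on \<open>\<real>\<^sup>3\<close>, which is faithful by the usual positivity argument for roots, a central
  element of \<open>W\<^sup>+\<close> is diagonal with entries \<open>\<plusminus>1\<close> and determinant 1.  The entries agree unless \<open>k = n = 2\<close>;
  there a nontrivial one would be the longest element of a dihedral group with \<open>m\<close> odd, which has odd length.
\<close>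

section \<open>Presented groups\<close>

lemma words_pos [simp]: "pos xs \<in> words S \<longleftrightarrow> set xs \<subseteq> S"
  by (force simp: words_def pos_def)

lemma pos_simps [simp]: "pos [] = []" "pos (x # xs) = (x, True) # pos xs" "pos (xs @ ys) = pos xs @ pos ys"
  by (simp_all add: pos_def)

lemma wpow_simps [simp]: "wpow 0 w = []" "wpow (Suc j) w = w @ wpow j w"
  by (simp_all add: wpow_def)

lemma words_wpow [simp]: "w \<in> words S \<Longrightarrow> wpow j w \<in> words S"
  by (induction j) auto

section \<open>Evaluation of words in a group\<close>

context group
begin

lemma eval_word_closed:
  assumes "\<And>x. x \<in> S \<Longrightarrow> f x \<in> carrier G" "w \<in> words S"
  shows "eval_word G f w \<in> carrier G"
  using assms(2) by (induction w) (auto simp: assms(1))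

lemma eval_word_append:
  assumes "\<And>x. x \<in> S \<Longrightarrow> f x \<in> carrier G" "v \<in> words S" "w \<in> words S"
  shows "eval_word G f (v @ w) = eval_word G f v \<otimes> eval_word G f w"
  using assms(2)
  by (induction v) (auto simp: assms(1,3) eval_word_closed[OF assms(1)] m_assoc)

lemma eval_word_wpow:
  assumes "\<And>x. x \<in> S \<Longrightarrow> f x \<in> carrier G" "w \<in> words S"
  shows "eval_word G f (wpow j w) = eval_word G f w [^] j"
proof (induction j)
  case (Suc j)
  have cl: "eval_word G f w \<in> carrier G" by (rule eval_word_closed[OF assms])
  have "eval_word G f (wpow (Suc j) w) = eval_word G f w \<otimes> eval_word G f (wpow j w)"
    unfolding wpow_simps by (rule eval_word_append[OF assms(1,2)]) (simp_all add: assms(2))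
  also have "\<dots> = eval_word G f w [^] Suc j"
    unfolding Suc.IH nat_pow_Suc2[OF cl] ..
  finally show ?case .
qed simp

lemma eval_word_cong:
  assumes "\<And>x. x \<in> S \<Longrightarrow> f x = g x" "w \<in> words S"
  shows "eval_word G f w = eval_word G g w"
  using assms(2) by (induction w) (auto simp: assms(1))

end

lemma (in group_hom) hom_eval_word:
  assumes "\<And>x. x \<in> S \<Longrightarrow> f x \<in> carrier G" "w \<in> words S"
  shows "h (eval_word G f w) = eval_word H (\<lambda>x. h (f x)) w"
  using assms(2)
  by (induction w) (auto simp: assms(1) G.eval_word_closed[OF assms(1)])

section \<open>Classes of words, and homomorphisms determined by generators\<close>

lemma pres_class_carrier [intro]:
  "w \<in> words S \<Longrightarrow> pres_class S R w \<in> carrier (presented_group S R)"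
  by (simp add: carrier_presented_group)

lemma pres_class_rel:
  assumes "(l, r) \<in> R" "l \<in> words S" "r \<in> words S"
  shows "pres_class S R l = pres_class S R r"
  using pres_rel.rel[OF assms, of "[]" "[]"] assms by (simp add: pres_class_eq_iff)

lemma pres_class_wpow:
  assumes "w \<in> words S"
  shows "pres_class S R (wpow j w) = pres_class S R w [^]\<^bsub>presented_group S R\<^esub> j"
proof -
  let ?P = "presented_group S R"
  interpret group ?P by (rule group_presented_group)
  show ?thesis
  proof (induction j)
    case (Suc j)
    have "pres_class S R (wpow (Suc j) w) = pres_class S R w \<otimes>\<^bsub>?P\<^esub> pres_class S R (wpow j w)"
      using assms by (simp add: mult_presented_group)
    then show ?case
      unfolding Suc.IH nat_pow_Suc2[OF pres_class_carrier[OF assms]] .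
  qed (simp add: one_presented_group)
qed

lemma pres_class_inverse_letter:
  assumes "x \<in> S"
  shows "pres_class S R [(x, False)] = inv\<^bsub>presented_group S R\<^esub> pres_class S R [(x, True)]"
proof -
  interpret group "presented_group S R" by (rule group_presented_group)
  have "([(x, False), (x, True)], []) \<in> pres_rel S R"
    using pres_rel.cancel[OF assms, of "[]" "[]" False R] by simp
  then show ?thesis
    using assms by (intro inv_equality[symmetric])
      (auto simp: mult_presented_group one_presented_group pres_class_eq_iff)
qed

lemma pres_class_eval_word:
  assumes "w \<in> words S"
  shows "pres_class S R w = eval_word (presented_group S R) (\<lambda>x. pres_class S R (pos [x])) w"
  using assms
proof (induction w)
  case (Cons a w)
  obtain x b where "a = (x, b)" by fastforce
  moreover have "pres_class S R (a # w) = pres_class S R [a] \<otimes>\<^bsub>presented_group S R\<^esub> pres_class S R w"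
    using Cons.prems by (simp add: mult_presented_group)
  moreover have "pres_class S R w = eval_word (presented_group S R) (\<lambda>x. pres_class S R [(x, True)]) w"
    using Cons by simp
  ultimately show ?case
    using Cons.prems by (simp add: pres_class_inverse_letter)
qed (simp add: one_presented_group)

lemma presented_group_hom_eq:
  assumes "h \<in> hom (presented_group S R) H" "h' \<in> hom (presented_group S R) H" "group H"
    and "\<And>x. x \<in> S \<Longrightarrow> h (pres_class S R (pos [x])) = h' (pres_class S R (pos [x]))"
    and "g \<in> carrier (presented_group S R)"
  shows "h g = h' g"
proof -
  let ?P = "presented_group S R"
  interpret group ?P by (rule group_presented_group)
  interpret H: group H by fact
  interpret h: group_hom ?P H h by unfold_locales (fact assms)
  interpret h': group_hom ?P H h' by unfold_locales (fact assms)
  obtain w where w: "w \<in> words S" "g = pres_class S R w"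
    using assms(5) by (auto simp: carrier_presented_group)
  let ?e = "\<lambda>x. pres_class S R (pos [x])"
  have gens: "\<And>x. x \<in> S \<Longrightarrow> ?e x \<in> carrier ?P" by auto
  have g: "g = eval_word ?P ?e w" unfolding w(2) by (rule pres_class_eval_word[OF w(1)])
  have "eval_word H (\<lambda>x. h (?e x)) w = eval_word H (\<lambda>x. h' (?e x)) w"
    using assms(4) w(1) by (rule H.eval_word_cong)
  then show ?thesis
    using h.hom_eval_word[where f = ?e, OF gens w(1)] h'.hom_eval_word[where f = ?e, OF gens w(1)]
    by (simp only: g)
qed

lemma presented_group_subgroup_eq:
  assumes "subgroup K (presented_group S R)"
    and "\<And>x. x \<in> S \<Longrightarrow> pres_class S R (pos [x]) \<in> K"
  shows "K = carrier (presented_group S R)"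
proof -
  let ?P = "presented_group S R"
  interpret group ?P by (rule group_presented_group)
  interpret K: subgroup K ?P by fact
  have "eval_word ?P (\<lambda>x. pres_class S R (pos [x])) w \<in> K" if "w \<in> words S" for w
    using that by (induction w) (use assms(2) in auto)
  then have "pres_class S R w \<in> K" if "w \<in> words S" for w
    unfolding pres_class_eval_word[OF that] using that by blast
  then show ?thesis
    using K.subset by (auto simp: carrier_presented_group)
qed

section \<open>Centralizers, the center and central subgroups\<close>

lemma (in group) centralizer_subgroup:
  assumes "a \<in> carrier G"
  shows "subgroup {g \<in> carrier G. a \<otimes> g = g \<otimes> a} G"
proof (rule subgroupI)
  fix g assume g: "g \<in> {g \<in> carrier G. a \<otimes> g = g \<otimes> a}"
  then have "inv g \<otimes> a = a \<otimes> inv g"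
    using assms by (metis (mono_tags, lifting) inv_closed inv_solve_left' inv_solve_right m_assoc m_closed mem_Collect_eq)
  with g show "inv g \<in> {g \<in> carrier G. a \<otimes> g = g \<otimes> a}"
    by simp
next
  fix g h assume gh: "g \<in> {g \<in> carrier G. a \<otimes> g = g \<otimes> a}" "h \<in> {g \<in> carrier G. a \<otimes> g = g \<otimes> a}"
  then have "a \<otimes> (g \<otimes> h) = g \<otimes> h \<otimes> a"
    using assms by (metis (mono_tags, lifting) m_assoc mem_Collect_eq)
  with gh show "g \<otimes> h \<in> {g \<in> carrier G. a \<otimes> g = g \<otimes> a}"
    by simp
qed (use assms in auto)

lemma (in group) center_subgroup: "subgroup (center G) G"
proof -
  have "center G = \<Inter>((\<lambda>a. {g \<in> carrier G. a \<otimes> g = g \<otimes> a}) ` carrier G)"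
    using one_closed by (fastforce simp: center_def)
  moreover have "subgroup (\<Inter>((\<lambda>a. {g \<in> carrier G. a \<otimes> g = g \<otimes> a}) ` carrier G)) G"
    by (rule subgroups_Inter) (use centralizer_subgroup in auto)
  ultimately show ?thesis by simp
qed

lemma (in group) subgroup_central_normal:
  assumes "subgroup N G" "N \<subseteq> center G"
  shows "N \<lhd> G"
proof -
  interpret N: subgroup N G by fact
  have "x \<otimes> h \<otimes> inv x = h" if "x \<in> carrier G" "h \<in> N" for x h
  proof -
    have h: "x \<otimes> h = h \<otimes> x" "h \<in> carrier G" using that assms(2) by (auto simp: center_def)
    then show ?thesis using that inv_solve_right' by simp
  qed
  then show ?thesis by (simp add: normal_inv_iff assms(1))
qed

lemma (in group) center_int_pow: "z \<in> center G \<Longrightarrow> z [^] (i::int) \<in> center G"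
  using subgroup_int_pow_closed[OF center_subgroup] .

lemma presented_group_centralI:
  assumes "a \<in> carrier (presented_group S R)"
    and "\<And>x. x \<in> S \<Longrightarrow> a \<otimes>\<^bsub>presented_group S R\<^esub> pres_class S R (pos [x])
           = pres_class S R (pos [x]) \<otimes>\<^bsub>presented_group S R\<^esub> a"
  shows "a \<in> center (presented_group S R)"
proof -
  let ?P = "presented_group S R"
  interpret group ?P by (rule group_presented_group)
  have "{g \<in> carrier ?P. a \<otimes>\<^bsub>?P\<^esub> g = g \<otimes>\<^bsub>?P\<^esub> a} = carrier ?P"
    by (rule presented_group_subgroup_eq[OF centralizer_subgroup[OF assms(1)]]) (use assms in auto)
  then show ?thesis
    using assms(1) by (auto simp: center_def)
qed


section \<open>The groups \<open>G\<close> and \<open>W(k, n, m)\<close>\<close>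

context group
begin

lemma cyclic_products_commute:
  assumes "s \<in> carrier G" "t \<in> carrier G" "u \<in> carrier G"
    and "t \<otimes> u \<otimes> s = s \<otimes> t \<otimes> u" "u \<otimes> s \<otimes> t = s \<otimes> t \<otimes> u"
  shows "s \<otimes> t \<otimes> u \<otimes> s = s \<otimes> (s \<otimes> t \<otimes> u)"
    and "s \<otimes> t \<otimes> u \<otimes> t = t \<otimes> (s \<otimes> t \<otimes> u)"
    and "s \<otimes> t \<otimes> u \<otimes> u = u \<otimes> (s \<otimes> t \<otimes> u)"
  using assms by (metis m_assoc m_closed)+

text \<open>The equation for \<open>u \<otimes> s \<otimes> t\<close> says that \<open>u\<close>
  commutes with \<open>s \<otimes> t\<close>, so the power splits and the factor
  \<open>u [^] m\<close> disappears.\<close>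

lemma cyclic_products_pow:
  assumes "s \<in> carrier G" "t \<in> carrier G" "u \<in> carrier G"
    and "u \<otimes> s \<otimes> t = s \<otimes> t \<otimes> u" "u [^] (m::nat) = \<one>"
  shows "(s \<otimes> t \<otimes> u) [^] m = (s \<otimes> t) [^] m"
proof -
  have "(s \<otimes> t \<otimes> u) [^] m = (s \<otimes> t) [^] m \<otimes> u [^] m"
    by (rule pow_mult_distrib) (use assms in \<open>auto simp: m_assoc\<close>)
  then show ?thesis using assms by simp
qed

lemma pow_mod:
  assumes "t \<in> carrier G" "t [^] (n::nat) = \<one>"
  shows "t [^] (i mod n) = t [^] i"
proof -
  have "t [^] i = t [^] (n * (i div n)) \<otimes> t [^] (i mod n)"
    using assms(1) by (simp add: nat_pow_mult)
  also have "t [^] (n * (i div n)) = \<one>"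
    using assms by (simp flip: nat_pow_pow)
  finally show ?thesis using assms(1) by simp
qed

text \<open>The product of consecutive conjugates telescopes: between two neighbours a single
  \<open>t\<close> survives. Multiplying by the power of \<open>t\<close> on the right keeps
  inverses out of the induction.\<close>

lemma eval_conjugates:
  assumes "s \<in> carrier G" "t \<in> carrier G" "i \<ge> 1"
    and "\<And>j. j \<ge> 1 \<Longrightarrow> f j = t [^] (j - 1) \<otimes> s \<otimes> inv (t [^] (j - 1))"
  shows "eval_word G f (pos [i..<i + l]) \<otimes> t [^] (i - 1 + l) = t [^] (i - 1) \<otimes> (s \<otimes> t) [^] l"
  using assms(3)
proof (induction l arbitrary: i)
  case (Suc l)
  have f: "f j \<in> carrier G" if "j \<in> {1..}" for j
    using assms that by simp
  have cl: "eval_word G f (pos [Suc i..<Suc i + l]) \<in> carrier G"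
    by (rule eval_word_closed[of "{1..}"]) (use f in auto)
  have "eval_word G f (pos [i..<i + Suc l]) = f i \<otimes> eval_word G f (pos [Suc i..<Suc i + l])"
    using upt_conv_Cons[of i "i + Suc l"] by (simp del: upt_Suc)
  then have "eval_word G f (pos [i..<i + Suc l]) \<otimes> t [^] (i - 1 + Suc l) =
      f i \<otimes> (eval_word G f (pos [Suc i..<Suc i + l]) \<otimes> t [^] (Suc i - 1 + l))"
    using Suc.prems assms(2) f[of i] cl by (simp add: m_assoc del: nat_pow_Suc)
  also have "\<dots> = f i \<otimes> (t [^] i \<otimes> (s \<otimes> t) [^] l)"
    by (subst Suc.IH) simp_all
  also have "t [^] i = t [^] (i - 1) \<otimes> t"
    using Suc.prems by (metis Suc_diff_1 less_eq_Suc_le One_nat_def nat_pow_Suc)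
  also have "f i \<otimes> (t [^] (i - 1) \<otimes> t \<otimes> (s \<otimes> t) [^] l) = t [^] (i - 1) \<otimes> (s \<otimes> t \<otimes> (s \<otimes> t) [^] l)"
    using assms Suc.prems by (simp add: m_assoc inv_solve_left')
  finally show ?case
    using assms by (metis m_closed nat_pow_Suc2)
qed (use assms in simp)

end

lemma eval_word_pos_map: "eval_word H f (pos (map g xs)) = eval_word H (\<lambda>x. f (g x)) (pos xs)"
  by (induction xs) auto

lemma idx_range: "n \<ge> 1 \<Longrightarrow> idx n i \<in> {1..n}"
  by (simp add: idx_def Suc_leI)

lemma idx_id: "i \<in> {1..n} \<Longrightarrow> idx n i = i"
  by (auto simp: idx_def)

lemma idx_add_mult: "i \<ge> 1 \<Longrightarrow> idx n (i + n * j) = idx n i"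
  by (metis Nat.add_diff_assoc2 idx_def mod_mult_self2)

lemma idx_add: "i \<ge> 1 \<Longrightarrow> idx n (i + j) = idx n (idx n i + j)"
  by (cases i) (simp_all add: idx_def mod_add_left_eq)

section \<open>Relations in \<open>G\<close> and in \<open>W(k, n, m)\<close>\<close>

locale toric_parameters =
  fixes k n m :: nat
  assumes n_pos: "n \<ge> 1" and m_pos: "m \<ge> 1" and coprime: "coprime n m"
begin

abbreviation G where "G \<equiv> J_group k n m"
abbreviation s where "s \<equiv> J_gen k n m Gs"
abbreviation t where "t \<equiv> J_gen k n m Gt"
abbreviation u where "u \<equiv> J_gen k n m Gu"
abbreviation z where "z \<equiv> J_stu k n m"
abbreviation W where "W \<equiv> toric_group k n m"
abbreviation c where "c \<equiv> toric_c k n m"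
abbreviation incl where "incl \<equiv> toric_incl k n m"

text \<open>Segments of the periodic product of the generators. They give the generators,
  \<open>\<delta>\<close> and \<open>c\<close> a common form, so that identities follow by cutting a
  segment in two ways.\<close>

definition seg :: "nat \<Rightarrow> nat \<Rightarrow> nat word set" where
  "seg i l = pres_class (toric_gens n) (toric_rels k n m) (pos (map (idx n) [i..<i + l]))"

abbreviation y where "y i \<equiv> seg i (Suc 0)"
abbreviation \<delta> where "\<delta> \<equiv> seg (Suc 0) m"

sublocale G: group G
  unfolding J_group_def by (rule group_presented_group)

sublocale W: group W
  unfolding toric_group_def by (rule group_presented_group)

lemma stu_closed [simp]: "s \<in> carrier G" "t \<in> carrier G" "u \<in> carrier G"
  by (auto simp: J_gen_def J_group_def J_gens_def)

lemma z_eq: "z = s \<otimes>\<^bsub>G\<^esub> t \<otimes>\<^bsub>G\<^esub> u"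
  by (simp add: J_gen_def J_group_def J_gens_def J_stu_def mult_presented_group)

lemma J_pow_relations:
  "s [^]\<^bsub>G\<^esub> k = \<one>\<^bsub>G\<^esub>" "t [^]\<^bsub>G\<^esub> n = \<one>\<^bsub>G\<^esub>" "u [^]\<^bsub>G\<^esub> m = \<one>\<^bsub>G\<^esub>"
proof -
  have "pres_class J_gens (J_rels k n m) (wpow k (pos [Gs])) = pres_class J_gens (J_rels k n m) []"
    "pres_class J_gens (J_rels k n m) (wpow n (pos [Gt])) = pres_class J_gens (J_rels k n m) []"
    "pres_class J_gens (J_rels k n m) (wpow m (pos [Gu])) = pres_class J_gens (J_rels k n m) []"
    by (intro pres_class_rel words_wpow; simp add: J_rels_def J_gens_def)+
  then show "s [^]\<^bsub>G\<^esub> k = \<one>\<^bsub>G\<^esub>" "t [^]\<^bsub>G\<^esub> n = \<one>\<^bsub>G\<^esub>" "u [^]\<^bsub>G\<^esub> m = \<one>\<^bsub>G\<^esub>"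
    by (simp_all add: pres_class_wpow J_gen_def J_group_def J_gens_def one_presented_group)
qed

lemma z_cyclic: "t \<otimes>\<^bsub>G\<^esub> u \<otimes>\<^bsub>G\<^esub> s = s \<otimes>\<^bsub>G\<^esub> t \<otimes>\<^bsub>G\<^esub> u" "u \<otimes>\<^bsub>G\<^esub> s \<otimes>\<^bsub>G\<^esub> t = s \<otimes>\<^bsub>G\<^esub> t \<otimes>\<^bsub>G\<^esub> u"
proof -
  have "pres_class J_gens (J_rels k n m) (pos [Gs, Gt, Gu]) = pres_class J_gens (J_rels k n m) (pos [Gt, Gu, Gs])"
    "pres_class J_gens (J_rels k n m) (pos [Gt, Gu, Gs]) = pres_class J_gens (J_rels k n m) (pos [Gu, Gs, Gt])"
    by (intro pres_class_rel; simp add: J_rels_def J_gens_def)+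
  then show "t \<otimes>\<^bsub>G\<^esub> u \<otimes>\<^bsub>G\<^esub> s = s \<otimes>\<^bsub>G\<^esub> t \<otimes>\<^bsub>G\<^esub> u" "u \<otimes>\<^bsub>G\<^esub> s \<otimes>\<^bsub>G\<^esub> t = s \<otimes>\<^bsub>G\<^esub> t \<otimes>\<^bsub>G\<^esub> u"
    by (simp_all add: J_gen_def J_group_def J_gens_def mult_presented_group)
qed

lemma z_center: "z \<in> center G"
  unfolding J_group_def
proof (rule presented_group_centralI, fold J_group_def)
  show "z \<in> carrier G" by (simp add: z_eq)
next
  fix x assume "x \<in> J_gens"
  then have "z \<otimes>\<^bsub>G\<^esub> J_gen k n m x = J_gen k n m x \<otimes>\<^bsub>G\<^esub> z"
    using G.cyclic_products_commute[OF stu_closed z_cyclic] by (auto simp: J_gens_def z_eq)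
  then show "z \<otimes>\<^bsub>G\<^esub> pres_class J_gens (J_rels k n m) (pos [x])
       = pres_class J_gens (J_rels k n m) (pos [x]) \<otimes>\<^bsub>G\<^esub> z"
    by (simp add: J_gen_def)
qed

lemma z_closed [simp]: "z \<in> carrier G"
  using z_center by (simp add: center_def)

lemma z_pow_m: "(s \<otimes>\<^bsub>G\<^esub> t) [^]\<^bsub>G\<^esub> m = z [^]\<^bsub>G\<^esub> m"
  unfolding z_eq by (rule G.cyclic_products_pow[symmetric]) (simp_all add: z_cyclic J_pow_relations)

lemma G_hom_eq:
  assumes "h \<in> hom G H" "h' \<in> hom G H" "group H" "h s = h' s" "h t = h' t" "h u = h' u" "g \<in> carrier G"
  shows "h g = h' g"
  using assms presented_group_hom_eq[of h J_gens "J_rels k n m" H h' g]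
  by (auto simp: J_group_def J_gen_def J_gens_def)

lemma idx_gens [simp]: "idx n i \<in> toric_gens n"
  using idx_range[OF n_pos] by (simp add: toric_gens_def)

lemma seg_words: "pos (map (idx n) [i..<i + l]) \<in> words (toric_gens n)"
  by auto

lemma seg_closed [simp]: "seg i l \<in> carrier W"
  unfolding seg_def toric_group_def by (intro pres_class_carrier seg_words)

lemma seg_0: "seg i 0 = \<one>\<^bsub>W\<^esub>"
  by (simp add: seg_def toric_group_def one_presented_group)

lemma seg_add: "seg i (a + b) = seg i a \<otimes>\<^bsub>W\<^esub> seg (i + a) b"
proof -
  have "[i..<i + (a + b)] = [i..<i + a] @ [i + a..<i + a + b]"
    using upt_add_eq_append[of i "i + a" b] by (simp add: add.assoc)
  then show ?thesis
    unfolding seg_def toric_group_def by (subst mult_presented_group[OF seg_words seg_words]) simp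
qed

text \<open>The relations cover the starting points from 2 to \<open>n\<close>; every other one
  reduces to these or to 1 by periodicity of the indices.\<close>

lemma seg_window:
  assumes "i \<ge> 1" shows "seg i m = \<delta>"
proof -
  have "map (idx n) [i..<i + m] = map (idx n) [idx n i..<idx n i + m]"
  proof (rule nth_equalityI)
    fix j assume "j < length (map (idx n) [i..<i + m])"
    then show "map (idx n) [i..<i + m] ! j = map (idx n) [idx n i..<idx n i + m] ! j"
      using assms idx_add[of i n j] by simp
  qed simp
  then have "seg i m = seg (idx n i) m" by (simp add: seg_def)
  also have "\<dots> = \<delta>"
  proof (cases "idx n i = 1")
    case False
    then have "idx n i \<in> {2..n}" using idx_range[OF n_pos, of i] by auto
    then have "(pos (map (idx n) [1..<1 + m]), pos (map (idx n) [idx n i..<idx n i + m])) \<in> toric_rels k n m"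
      by (auto simp: toric_rels_def)
    then have "(pos (map (idx n) [Suc 0..<Suc 0 + m]), pos (map (idx n) [idx n i..<idx n i + m])) \<in> toric_rels k n m"
      by simp
    then show ?thesis
      unfolding seg_def by (intro pres_class_rel[symmetric] seg_words)
  qed simp
  finally show ?thesis .
qed

lemma y_periodic: "i \<ge> 1 \<Longrightarrow> y (i + n * j) = y i"
  by (simp add: seg_def idx_add_mult)

text \<open>Cut the segment of length \<open>m + 1\<close> that starts at \<open>i\<close> after its
  first letter and before its last one.\<close>

lemma y_delta: "i \<ge> 1 \<Longrightarrow> y i \<otimes>\<^bsub>W\<^esub> \<delta> = \<delta> \<otimes>\<^bsub>W\<^esub> y (i + m)"
  using seg_add[of i "Suc 0" m] seg_add[of i m "Suc 0"] seg_window[of "i + 1"] seg_window[of i] by (simp add: add.commute)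

lemma y_delta_pow: "i \<ge> 1 \<Longrightarrow> y i \<otimes>\<^bsub>W\<^esub> \<delta> [^]\<^bsub>W\<^esub> j = \<delta> [^]\<^bsub>W\<^esub> j \<otimes>\<^bsub>W\<^esub> y (i + m * j)"
proof (induction j)
  case (Suc j)
  have "y i \<otimes>\<^bsub>W\<^esub> \<delta> [^]\<^bsub>W\<^esub> Suc j = \<delta> [^]\<^bsub>W\<^esub> j \<otimes>\<^bsub>W\<^esub> y (i + m * j) \<otimes>\<^bsub>W\<^esub> \<delta>"
    using Suc by (simp flip: W.m_assoc)
  also have "\<dots> = \<delta> [^]\<^bsub>W\<^esub> Suc j \<otimes>\<^bsub>W\<^esub> y (i + m * j + m)"
    using Suc.prems by (simp add: W.m_assoc y_delta)
  finally show ?case by (simp add: algebra_simps)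
qed simp

lemma delta_pow: "\<delta> [^]\<^bsub>W\<^esub> j = seg 1 (m * j)"
proof (induction j)
  case (Suc j)
  then show ?case using seg_add[of 1 "m * j" m] seg_window[of "1 + m * j"] by (simp add: algebra_simps)
qed (simp add: seg_0)

lemma c_eq_seg: "c = seg 1 (n * m)"
proof -
  have *: "wpow j (pos [1..<1 + n]) = pos (map (idx n) [1..<1 + n * j])" for j
  proof (induction j)
    case (Suc j)
    have 1: "map (idx n) [1..<1 + n] = [1..<1 + n]"
      by (rule map_idI) (auto simp: idx_def)
    have 2: "map (idx n) [1 + n..<1 + n + n * j] = map (idx n) [1..<1 + n * j]"
    proof (rule nth_equalityI)
      fix i assume "i < length (map (idx n) [1 + n..<1 + n + n * j])"
      then have "i < n * j" by (simp del: upt_Suc)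
      then show "map (idx n) [1 + n..<1 + n + n * j] ! i = map (idx n) [1..<1 + n * j] ! i"
        by (simp add: idx_def del: upt_Suc)
    qed (simp del: upt_Suc)
    have "[1..<1 + n * Suc j] = [1..<1 + n] @ [1 + n..<1 + n + n * j]"
      using upt_add_eq_append[of 1 "1 + n" "n * j"] by (simp add: add.assoc)
    then show ?case using 1 2 Suc by (simp del: upt_Suc)
  qed simp
  show ?thesis unfolding toric_c_def seg_def * ..
qed

text \<open>The segment of length \<open>n * m\<close> consists of \<open>m\<close> blocks of length
  \<open>n\<close> and also of \<open>n\<close> blocks of length \<open>m\<close>.\<close>

lemma c_eq: "c = \<delta> [^]\<^bsub>W\<^esub> n"
  by (simp add: c_eq_seg delta_pow mult.commute)

lemma c_closed [simp]: "c \<in> carrier W"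
  by (simp add: c_eq_seg)

lemma y_gen: "i \<in> toric_gens n \<Longrightarrow> y i = pres_class (toric_gens n) (toric_rels k n m) (pos [i])"
  by (simp add: seg_def toric_gens_def idx_id)

text \<open>Conjugation by \<open>\<delta>\<close> to the power \<open>n\<close> shifts indices by
  \<open>m * n\<close>, a multiple of the period.\<close>

lemma c_center: "c \<in> center W"
  unfolding toric_group_def
proof (rule presented_group_centralI, fold toric_group_def)
  fix i assume i: "i \<in> toric_gens n"
  then have "i \<ge> 1" by (simp add: toric_gens_def)
  then have "c \<otimes>\<^bsub>W\<^esub> y i = y i \<otimes>\<^bsub>W\<^esub> c"
    using y_delta_pow[of i n] y_periodic[of i m] by (simp add: c_eq mult.commute)
  then show "c \<otimes>\<^bsub>W\<^esub> pres_class (toric_gens n) (toric_rels k n m) (pos [i])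
      = pres_class (toric_gens n) (toric_rels k n m) (pos [i]) \<otimes>\<^bsub>W\<^esub> c"
    using i by (simp only: y_gen)
qed simp

lemma W_hom_eq:
  assumes "h \<in> hom W H" "h' \<in> hom W H" "group H" "\<And>i. i \<in> {1..n} \<Longrightarrow> h (y i) = h' (y i)" "g \<in> carrier W"
  shows "h g = h' g"
  using presented_group_hom_eq[of h "toric_gens n" "toric_rels k n m" H h' g,
      folded toric_group_def, OF assms(1-3) _ assms(5)] assms(4) y_gen
  by (metis toric_gens_def)

end


lemma (in group) mult_inv_cancel:
  assumes "a \<in> carrier G" "b \<in> carrier G"
  shows "a \<otimes> (inv a \<otimes> b) = b" "inv a \<otimes> (a \<otimes> b) = b"
  using assms by (simp_all flip: m_assoc)

lemma (in group) conj_pow: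
  assumes "a \<in> carrier G" "x \<in> carrier G"
  shows "(a \<otimes> x \<otimes> inv a) [^] (j::nat) = a \<otimes> x [^] j \<otimes> inv a"
proof (induction j)
  case (Suc j)
  have "a \<otimes> x [^] j \<otimes> inv a \<otimes> (a \<otimes> x \<otimes> inv a) = a \<otimes> (x [^] j \<otimes> x) \<otimes> inv a"
    using assms by (simp add: m_assoc inv_solve_left')
  then show ?case using Suc by simp
qed (use assms in simp)

section \<open>The homomorphism from \<open>W(k, n, m)\<close> to \<open>G\<close>\<close>

context toric_parameters
begin

definition conj_s :: "nat \<Rightarrow> jgen word set" where
  "conj_s i = t [^]\<^bsub>G\<^esub> (i - 1) \<otimes>\<^bsub>G\<^esub> s \<otimes>\<^bsub>G\<^esub> inv\<^bsub>G\<^esub> (t [^]\<^bsub>G\<^esub> (i - 1))"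

lemma conj_s_closed [simp]: "conj_s i \<in> carrier G"
  by (simp add: conj_s_def)

lemma conj_s_idx: "i \<ge> 1 \<Longrightarrow> conj_s (idx n i) = conj_s i"
  unfolding conj_s_def idx_def by (simp add: G.pow_mod J_pow_relations)

lemma eval_conj_s:
  assumes "i \<ge> 1"
  shows "eval_word G conj_s (pos (map (idx n) [i..<i + l])) =
    t [^]\<^bsub>G\<^esub> (i - 1) \<otimes>\<^bsub>G\<^esub> (s \<otimes>\<^bsub>G\<^esub> t) [^]\<^bsub>G\<^esub> l \<otimes>\<^bsub>G\<^esub> inv\<^bsub>G\<^esub> (t [^]\<^bsub>G\<^esub> (i - 1 + l))"
proof -
  have "eval_word G (\<lambda>i. conj_s (idx n i)) (pos [i..<i + l]) \<in> carrier G"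
    by (rule G.eval_word_closed[of UNIV]) auto
  moreover have "conj_s (idx n j) = t [^]\<^bsub>G\<^esub> (j - 1) \<otimes>\<^bsub>G\<^esub> s \<otimes>\<^bsub>G\<^esub> inv\<^bsub>G\<^esub> (t [^]\<^bsub>G\<^esub> (j - 1))" if "j \<ge> 1" for j
    using conj_s_idx[OF that] by (simp add: conj_s_def)
  ultimately show ?thesis
    using G.eval_conjugates[of s t i "\<lambda>i. conj_s (idx n i)" l] assms
    unfolding eval_word_pos_map by (simp add: G.inv_solve_right)
qed

lemma st_pow_center: "(s \<otimes>\<^bsub>G\<^esub> t) [^]\<^bsub>G\<^esub> m \<in> center G"
  using G.center_int_pow[OF z_center, of "int m"] by (simp add: z_pow_m int_pow_int)

text \<open>Since \<open>z\<close> is central, the telescoped product loses its dependence on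
  \<open>i\<close>. This verifies the window relations of \<open>W\<close> for the conjugates of
  \<open>s\<close>.\<close>

lemma eval_conj_s_window:
  assumes "i \<ge> 1"
  shows "eval_word G conj_s (pos (map (idx n) [i..<i + m])) = z [^]\<^bsub>G\<^esub> m \<otimes>\<^bsub>G\<^esub> inv\<^bsub>G\<^esub> (t [^]\<^bsub>G\<^esub> m)"
proof -
  have "t [^]\<^bsub>G\<^esub> (i - 1) \<otimes>\<^bsub>G\<^esub> z [^]\<^bsub>G\<^esub> m = z [^]\<^bsub>G\<^esub> m \<otimes>\<^bsub>G\<^esub> t [^]\<^bsub>G\<^esub> (i - 1)"
    using st_pow_center by (simp add: center_def z_pow_m)
  moreover have "t [^]\<^bsub>G\<^esub> (i - 1) \<otimes>\<^bsub>G\<^esub> inv\<^bsub>G\<^esub> (t [^]\<^bsub>G\<^esub> (i - 1 + m)) = inv\<^bsub>G\<^esub> (t [^]\<^bsub>G\<^esub> m)"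
    by (subst add.commute) (simp add: G.inv_mult_group G.inv_solve_left' flip: G.nat_pow_mult G.m_assoc)
  ultimately show ?thesis
    using assms by (simp add: eval_conj_s z_pow_m G.m_assoc)
qed

lemma conj_s_relations:
  assumes "(l, r) \<in> toric_rels k n m"
  shows "eval_word G conj_s l = eval_word G conj_s r"
proof -
  consider i where "i \<in> {1..n}" "l = wpow k (pos [i])" "r = []"
    | i where "i \<in> {2..n}" "l = pos (map (idx n) [1..<1 + m])" "r = pos (map (idx n) [i..<i + m])"
    using assms by (auto simp: toric_rels_def)
  then show ?thesis
  proof cases
    case 1
    have "eval_word G conj_s (wpow k (pos [i])) = eval_word G conj_s (pos [i]) [^]\<^bsub>G\<^esub> k"
      by (rule G.eval_word_wpow[of UNIV]) auto
    then show ?thesis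
      using 1 by (simp add: conj_s_def G.conj_pow J_pow_relations)
  next
    case 2
    then show ?thesis using eval_conj_s_window[of 1] eval_conj_s_window[of i] by simp
  qed
qed

lemma incl_hom: "incl \<in> hom W G"
  and incl_eval: "w \<in> words (toric_gens n) \<Longrightarrow> incl (pres_class (toric_gens n) (toric_rels k n m) w) = eval_word G conj_s w"
proof -
  have incl: "incl = pres_hom G conj_s" by (simp add: toric_incl_def conj_s_def[abs_def])
  show "incl \<in> hom W G"
    unfolding incl toric_group_def by (rule pres_hom(1)) (use conj_s_relations in auto)
  show "incl (pres_class (toric_gens n) (toric_rels k n m) w) = eval_word G conj_s w"
    if "w \<in> words (toric_gens n)"
    unfolding incl by (rule pres_hom(2)) (use conj_s_relations that in auto)
qed

sublocale incl: group_hom W G incl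
  by unfold_locales (rule incl_hom)

lemma incl_seg:
  "i \<ge> 1 \<Longrightarrow> incl (seg i l) = t [^]\<^bsub>G\<^esub> (i - 1) \<otimes>\<^bsub>G\<^esub> (s \<otimes>\<^bsub>G\<^esub> t) [^]\<^bsub>G\<^esub> l \<otimes>\<^bsub>G\<^esub> inv\<^bsub>G\<^esub> (t [^]\<^bsub>G\<^esub> (i - 1 + l))"
  unfolding seg_def by (simp only: incl_eval[OF seg_words] eval_conj_s)

lemma incl_y: "i \<ge> 1 \<Longrightarrow> incl (y i) = conj_s i"
  by (cases i) (simp_all add: incl_seg conj_s_def G.inv_mult_group G.m_assoc G.mult_inv_cancel)

lemma incl_delta: "incl \<delta> = z [^]\<^bsub>G\<^esub> m \<otimes>\<^bsub>G\<^esub> inv\<^bsub>G\<^esub> (t [^]\<^bsub>G\<^esub> m)"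
  by (simp add: incl_seg z_pow_m)

lemma incl_c: "incl c = z [^]\<^bsub>G\<^esub> (n * m)"
proof -
  have "t [^]\<^bsub>G\<^esub> (n * m) = \<one>\<^bsub>G\<^esub>"
    by (simp add: J_pow_relations flip: G.nat_pow_pow)
  moreover have "(s \<otimes>\<^bsub>G\<^esub> t) [^]\<^bsub>G\<^esub> (m * n) = z [^]\<^bsub>G\<^esub> (m * n)"
    by (simp add: z_pow_m flip: G.nat_pow_pow)
  ultimately show ?thesis
    by (simp add: c_eq_seg incl_seg mult.commute)
qed

end


section \<open>Injectivity of the inclusion\<close>

context toric_parameters
begin

abbreviation D where "D \<equiv> W \<times>\<times> integer_group"

text \<open>In the quotient by this subgroup, \<open>c\<close> becomes the power
  \<open>n * m\<close> of the class of \<open>(\<one>, 1)\<close>, in agreement with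
  \<open>incl_c\<close>.\<close>

definition C :: "(nat word set \<times> int) set" where
  "C = {(c [^]\<^bsub>W\<^esub> i, - i * int (n * m)) | i. True}"

sublocale D: group D
  by (intro DirProd_group W.is_group group_integer_group)

lemma D_simps [simp]:
  "(a, i) \<otimes>\<^bsub>D\<^esub> (b, j) = (a \<otimes>\<^bsub>W\<^esub> b, i + j)"
  "\<one>\<^bsub>D\<^esub> = (\<one>\<^bsub>W\<^esub>, 0)"
  "(a, i) \<in> carrier D \<longleftrightarrow> a \<in> carrier W"
  by (simp_all add: DirProd_def)

lemma D_inv [simp]: "a \<in> carrier W \<Longrightarrow> inv\<^bsub>D\<^esub> (a, i) = (inv\<^bsub>W\<^esub> a, - i)"
  by (simp add: inv_DirProd)

lemma D_pow: "a \<in> carrier W \<Longrightarrow> (a, i) [^]\<^bsub>D\<^esub> (j::nat) = (a [^]\<^bsub>W\<^esub> j, int j * i)"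
  by (induction j) (simp_all add: algebra_simps)

lemma C_normal: "C \<lhd> D"
proof (rule D.subgroup_central_normal)
  show "subgroup C D"
  proof (rule D.subgroupI)
    fix a assume "a \<in> C"
    then obtain i where "a = (c [^]\<^bsub>W\<^esub> i, - i * int (n * m))" by (auto simp: C_def)
    then have "inv\<^bsub>D\<^esub> a = (c [^]\<^bsub>W\<^esub> (- i), - (- i) * int (n * m))"
      by (simp add: W.int_pow_neg)
    then show "inv\<^bsub>D\<^esub> a \<in> C" unfolding C_def by blast
  next
    fix a b assume "a \<in> C" "b \<in> C"
    then obtain i j where "a = (c [^]\<^bsub>W\<^esub> i, - i * int (n * m))" "b = (c [^]\<^bsub>W\<^esub> j, - j * int (n * m))"
      by (auto simp: C_def)
    then have "a \<otimes>\<^bsub>D\<^esub> b = (c [^]\<^bsub>W\<^esub> (i + j), - (i + j) * int (n * m))"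
      by (simp add: W.int_pow_mult algebra_simps)
    then show "a \<otimes>\<^bsub>D\<^esub> b \<in> C" unfolding C_def by blast
  qed (auto simp: C_def)
  show "C \<subseteq> center D"
  proof
    fix a assume "a \<in> C"
    then obtain i where a: "a = (c [^]\<^bsub>W\<^esub> i, - i * int (n * m))" by (auto simp: C_def)
    have "c [^]\<^bsub>W\<^esub> i \<in> center W" by (rule W.center_int_pow[OF c_center])
    then show "a \<in> center D" by (auto simp: a center_def)
  qed
qed

sublocale C: normal C D by (rule C_normal)

abbreviation Q where "Q \<equiv> D Mod C"
abbreviation q where "q a \<equiv> C #>\<^bsub>D\<^esub> a"

sublocale Q: group Q by (rule C.factorgroup_is_group)

sublocale q: group_hom D Q q
  by unfold_locales (rule C.r_coset_hom_Mod)

lemma q_eq_one: "a \<in> carrier D \<Longrightarrow> q a = \<one>\<^bsub>Q\<^esub> \<longleftrightarrow> a \<in> C"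
  using D.coset_join1 D.coset_join2 C.subgroup_axioms C.subset by (metis one_FactGroup)

text \<open>An inverse of \<open>m\<close> modulo \<open>n\<close>. It is chosen with a natural
  number \<open>l\<close>, so that all exponents below stay natural.\<close>

definition shift_exp :: nat where
  "shift_exp = (SOME x. \<exists>l. m * x = 1 + n * l)"

lemma shift_exp_bezout: obtains l where "m * shift_exp = 1 + n * l"
proof -
  have "\<exists>x l. m * x = 1 + n * l"
    using bezout_nat[of m n] m_pos coprime by (auto simp: gcd.commute coprime_iff_gcd_eq_1)
  then have "\<exists>l. m * shift_exp = 1 + n * l"
    unfolding shift_exp_def by (rule someI_ex)
  then show thesis using that by blast
qed

text \<open>The images of \<open>s\<close>, \<open>t\<close>, \<open>z\<close>, \<open>u\<close>: conjugation by \<open>\<delta>\<close> to the power \<open>- shift_exp\<close> shifts indices by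
  \<open>m * shift_exp\<close>, which is 1 modulo \<open>n\<close>, and the second component of \<open>tD\<close> puts its \<open>n\<close>-th power into \<open>C\<close>.\<close>

abbreviation sD where "sD \<equiv> (y 1, 0 :: int)"
abbreviation tD where "tD \<equiv> (inv\<^bsub>W\<^esub> (\<delta> [^]\<^bsub>W\<^esub> shift_exp), int (m * shift_exp))"
abbreviation zD where "zD \<equiv> (\<one>\<^bsub>W\<^esub>, 1 :: int)"
abbreviation uD where "uD \<equiv> inv\<^bsub>D\<^esub> (sD \<otimes>\<^bsub>D\<^esub> tD) \<otimes>\<^bsub>D\<^esub> zD"

text \<open>The total shift \<open>m * shift_exp * j\<close> is \<open>j\<close> modulo
  \<open>n\<close>. Hence this power of \<open>\<delta>\<close> conjugates the first generator just
  as the power \<open>j\<close> of \<open>t\<close> conjugates \<open>s\<close> in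
  \<open>G\<close>.\<close>

lemma delta_conj_y:
  "inv\<^bsub>W\<^esub> (\<delta> [^]\<^bsub>W\<^esub> (shift_exp * j)) \<otimes>\<^bsub>W\<^esub> y 1 = y (1 + j) \<otimes>\<^bsub>W\<^esub> inv\<^bsub>W\<^esub> (\<delta> [^]\<^bsub>W\<^esub> (shift_exp * j))"
proof -
  obtain l where l: "m * shift_exp = 1 + n * l" by (rule shift_exp_bezout)
  have "1 + m * (shift_exp * j) = (1 + j) + n * (l * j)"
    using l by (metis add.assoc add_mult_distrib mult.assoc mult_1)
  then have "y (1 + m * (shift_exp * j)) = y (1 + j)"
    using y_periodic[of "1 + j" "l * j"] by simp
  then have "y 1 \<otimes>\<^bsub>W\<^esub> \<delta> [^]\<^bsub>W\<^esub> (shift_exp * j) = \<delta> [^]\<^bsub>W\<^esub> (shift_exp * j) \<otimes>\<^bsub>W\<^esub> y (1 + j)"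
    using y_delta_pow[of 1 "shift_exp * j"] by simp
  then have "inv\<^bsub>W\<^esub> (\<delta> [^]\<^bsub>W\<^esub> (shift_exp * j)) \<otimes>\<^bsub>W\<^esub> y 1 \<otimes>\<^bsub>W\<^esub> \<delta> [^]\<^bsub>W\<^esub> (shift_exp * j) = y (1 + j)"
    by (simp add: W.m_assoc W.mult_inv_cancel)
  then show ?thesis
    by (simp add: W.inv_solve_right)
qed

lemma tD_pow: "tD [^]\<^bsub>D\<^esub> j = (inv\<^bsub>W\<^esub> (\<delta> [^]\<^bsub>W\<^esub> (shift_exp * j)), int (m * shift_exp * j))"
  by (simp add: D_pow W.nat_pow_inv W.nat_pow_pow)

text \<open>Moving the inverse powers of \<open>\<delta>\<close> to the right turns successive
  copies of \<open>y 1\<close> into consecutive generators. For \<open>j = m\<close> the resulting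
  segment is \<open>\<delta>\<close> itself, as needed for the order of \<open>uD\<close>.\<close>

lemma stD_pow: "(sD \<otimes>\<^bsub>D\<^esub> tD) [^]\<^bsub>D\<^esub> j = (seg 1 j \<otimes>\<^bsub>W\<^esub> inv\<^bsub>W\<^esub> (\<delta> [^]\<^bsub>W\<^esub> (shift_exp * j)), int (m * shift_exp * j))"
proof (induction j)
  case (Suc j)
  let ?d = "inv\<^bsub>W\<^esub> (\<delta> [^]\<^bsub>W\<^esub> (shift_exp * j))" and ?shift_exp = "inv\<^bsub>W\<^esub> (\<delta> [^]\<^bsub>W\<^esub> shift_exp)"
  have "seg 1 j \<otimes>\<^bsub>W\<^esub> ?d \<otimes>\<^bsub>W\<^esub> (y 1 \<otimes>\<^bsub>W\<^esub> ?shift_exp) = seg 1 j \<otimes>\<^bsub>W\<^esub> (?d \<otimes>\<^bsub>W\<^esub> y 1) \<otimes>\<^bsub>W\<^esub> ?shift_exp"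
    by (simp add: W.m_assoc)
  also have "\<dots> = seg 1 j \<otimes>\<^bsub>W\<^esub> y (1 + j) \<otimes>\<^bsub>W\<^esub> (?d \<otimes>\<^bsub>W\<^esub> ?shift_exp)"
    unfolding delta_conj_y by (simp add: W.m_assoc)
  also have "?d \<otimes>\<^bsub>W\<^esub> ?shift_exp = inv\<^bsub>W\<^esub> (\<delta> [^]\<^bsub>W\<^esub> (shift_exp * Suc j))"
    by (simp add: W.nat_pow_mult flip: W.inv_mult_group)
  also have "seg 1 j \<otimes>\<^bsub>W\<^esub> y (1 + j) = seg 1 (Suc j)"
    using seg_add[of 1 j 1] by simp
  finally show ?case using Suc by (simp add: algebra_simps)
qed (simp add: seg_0 D_simps)

lemma y_1_pow: "y 1 [^]\<^bsub>W\<^esub> k = \<one>\<^bsub>W\<^esub>"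
proof -
  have 1: "1 \<in> toric_gens n" using n_pos by (simp add: toric_gens_def)
  have "pres_class (toric_gens n) (toric_rels k n m) (wpow k (pos [1])) = pres_class (toric_gens n) (toric_rels k n m) []"
    by (intro pres_class_rel words_wpow) (use 1 in \<open>auto simp: toric_rels_def toric_gens_def\<close>)
  moreover have "pres_class (toric_gens n) (toric_rels k n m) (wpow k (pos [1])) = y 1 [^]\<^bsub>W\<^esub> k"
    unfolding y_gen[OF 1] toric_group_def by (rule pres_class_wpow) (use 1 in simp)
  ultimately show ?thesis by (simp add: toric_group_def one_presented_group)
qed

lemma tD_pow_n: "tD [^]\<^bsub>D\<^esub> n \<in> C"
proof -
  have "tD [^]\<^bsub>D\<^esub> n = (c [^]\<^bsub>W\<^esub> (- int shift_exp), - (- int shift_exp) * int (n * m))"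
    unfolding tD_pow by (simp add: c_eq W.int_pow_neg_int W.nat_pow_pow mult.commute)
  then show ?thesis unfolding C_def by blast
qed

text \<open>As \<open>zD\<close> is central, the power splits. Its first component is
  \<open>\<delta>\<close> to the power \<open>shift_exp * m - 1 = n * l\<close>, which is
  \<open>c\<close> to the power \<open>l\<close>; the second component is
  \<open>- l * n * m\<close>.\<close>

lemma uD_pow_m: "uD [^]\<^bsub>D\<^esub> m \<in> C"
proof -
  obtain l where l: "m * shift_exp = 1 + n * l" by (rule shift_exp_bezout)
  have "uD [^]\<^bsub>D\<^esub> m = inv\<^bsub>D\<^esub> ((sD \<otimes>\<^bsub>D\<^esub> tD) [^]\<^bsub>D\<^esub> m) \<otimes>\<^bsub>D\<^esub> zD [^]\<^bsub>D\<^esub> m"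
  proof -
    have comm: "a \<otimes>\<^bsub>D\<^esub> zD = zD \<otimes>\<^bsub>D\<^esub> a" if "a \<in> carrier D" for a
      using that by auto
    have cl: "inv\<^bsub>D\<^esub> (sD \<otimes>\<^bsub>D\<^esub> tD) \<in> carrier D" "sD \<otimes>\<^bsub>D\<^esub> tD \<in> carrier D" "zD \<in> carrier D" by simp_all
    show ?thesis
      unfolding D.pow_mult_distrib[OF comm[OF cl(1)] cl(1) cl(3)] D.nat_pow_inv[OF cl(2)] ..
  qed
  also have "\<dots> = inv\<^bsub>D\<^esub> (\<delta> \<otimes>\<^bsub>W\<^esub> inv\<^bsub>W\<^esub> (\<delta> [^]\<^bsub>W\<^esub> (shift_exp * m)), int (m * shift_exp * m)) \<otimes>\<^bsub>D\<^esub> (\<one>\<^bsub>W\<^esub>, int m)"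
    unfolding stD_pow by (simp add: D_pow)
  also have "\<dots> = (\<delta> [^]\<^bsub>W\<^esub> (n * l), - int l * int (n * m))"
  proof -
    have *: "shift_exp * m = Suc (n * l)" using l by (simp add: mult.commute)
    have "\<delta> [^]\<^bsub>W\<^esub> (shift_exp * m) \<otimes>\<^bsub>W\<^esub> inv\<^bsub>W\<^esub> \<delta> = \<delta> [^]\<^bsub>W\<^esub> (n * l)"
      unfolding * by (simp add: W.m_assoc)
    moreover have "int m - int (m * shift_exp * m) = - int l * int (n * m)"
      unfolding l by (simp add: algebra_simps)
    ultimately show ?thesis by (simp add: W.inv_mult_group)
  qed
  also have "\<dots> = (c [^]\<^bsub>W\<^esub> int l, - int l * int (n * m))"
    by (simp add: c_eq int_pow_int W.nat_pow_pow)
  finally show ?thesis unfolding C_def by blast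
qed

fun toD :: "jgen \<Rightarrow> nat word set \<times> int" where
  "toD Gs = sD" | "toD Gt = tD" | "toD Gu = uD"

lemma toD_closed [simp]: "toD x \<in> carrier D"
  by (cases x) simp_all

lemma q_toD_relations:
  assumes "(l, r) \<in> J_rels k n m"
  shows "eval_word Q (\<lambda>x. q (toD x)) l = eval_word Q (\<lambda>x. q (toD x)) r"
proof -
  have w: "w \<in> words (UNIV :: jgen set)" for w by (simp add: words_def)
  have ev: "eval_word Q (\<lambda>x. q (toD x)) w = q (eval_word D toD w)" for w
    by (rule q.hom_eval_word[of UNIV, symmetric]) (simp_all only: w toD_closed)
  have p: "eval_word D toD (wpow j (pos [x])) = toD x [^]\<^bsub>D\<^esub> j" for j x
    by (subst D.eval_word_wpow[of UNIV]) (simp_all only: w toD_closed pos_simps eval_word.simps if_True D.r_one)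
  have sD: "sD [^]\<^bsub>D\<^esub> k = \<one>\<^bsub>D\<^esub>"
    using y_1_pow by (simp add: D_pow)
  consider "l = wpow k (pos [Gs])" "r = []" | "l = wpow n (pos [Gt])" "r = []" | "l = wpow m (pos [Gu])" "r = []"
    | "l = pos [Gs, Gt, Gu]" "r = pos [Gt, Gu, Gs]" | "l = pos [Gt, Gu, Gs]" "r = pos [Gu, Gs, Gt]"
    using assms unfolding J_rels_def by blast
  then show ?thesis
  proof cases
    case 1
    then show ?thesis unfolding ev 1 p by (simp only: toD.simps sD eval_word.simps)
  next
    case 2
    have "q (tD [^]\<^bsub>D\<^esub> n) = \<one>\<^bsub>Q\<^esub>" using q_eq_one tD_pow_n C.subset by blast
    then show ?thesis unfolding ev 2 p by (simp only: toD.simps eval_word.simps q.hom_one)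
  next
    case 3
    have "q (uD [^]\<^bsub>D\<^esub> m) = \<one>\<^bsub>Q\<^esub>" using q_eq_one uD_pow_m C.subset by blast
    then show ?thesis unfolding ev 3 p by (simp only: toD.simps eval_word.simps q.hom_one)
  next
    \<comment> \<open>The cyclic relations hold already in \<open>D\<close>: as \<open>zD\<close> is
      central and \<open>uD\<close> is \<open>zD\<close> divided by \<open>sD \<otimes> tD\<close>,
      all three cyclic products equal \<open>zD\<close>. Only the orders of \<open>t\<close> and
      \<open>u\<close> require passing to the quotient.\<close>
    case 4
    show ?thesis unfolding ev 4 by (simp add: W.inv_mult_group W.m_assoc W.mult_inv_cancel)
  next
    case 5
    show ?thesis unfolding ev 5 by (simp add: W.inv_mult_group W.m_assoc W.mult_inv_cancel)
  qed
qed

section \<open>The homomorphism from \<open>G\<close> to the quotient of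
  \<open>W \<times> \<int>\<close>\<close>

definition toQ :: "jgen word set \<Rightarrow> (nat word set \<times> int) set" where
  "toQ = pres_hom Q (\<lambda>x. q (toD x))"

lemma toQ_hom: "toQ \<in> hom G Q"
  unfolding toQ_def J_group_def by (rule pres_hom(1)[OF Q.is_group _ q_toD_relations]) (rule q.hom_closed[OF toD_closed])

lemma toQ_gen: "toQ (J_gen k n m x) = q (toD x)"
proof -
  have "pos [x] \<in> words J_gens" by (cases x) (auto simp: J_gens_def)
  have "toQ (J_gen k n m x) = eval_word Q (\<lambda>x. q (toD x)) (pos [x])"
    unfolding toQ_def J_gen_def
    by (rule pres_hom(2)[OF Q.is_group _ q_toD_relations]) (rule q.hom_closed[OF toD_closed], assumption, fact)
  then show ?thesis
    using Q.r_one[OF q.hom_closed[OF toD_closed[of x]]] by (simp only: pos_simps eval_word.simps if_True)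
qed

sublocale toQ: group_hom G Q toQ
  by unfold_locales (rule toQ_hom)

lemma toQ_z: "toQ z = q zD"
proof -
  have "toQ z = q (toD Gs) \<otimes>\<^bsub>Q\<^esub> q (toD Gt) \<otimes>\<^bsub>Q\<^esub> q (toD Gu)"
    by (simp only: z_eq toQ_gen toQ.hom_mult stu_closed G.m_closed)
  also have "\<dots> = q (toD Gs \<otimes>\<^bsub>D\<^esub> toD Gt \<otimes>\<^bsub>D\<^esub> toD Gu)"
    by (simp only: q.hom_mult toD_closed D.m_closed)
  finally show ?thesis by (simp add: W.m_assoc W.mult_inv_cancel W.inv_mult_group)
qed

text \<open>It suffices to compare generators. Conjugating \<open>sD\<close> by a power of
  \<open>tD\<close> cancels the integer components, and \<open>delta_conj_y\<close> identifies what
  remains.\<close>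

lemma toQ_incl:
  assumes "w \<in> carrier W"
  shows "toQ (incl w) = q (w, 0)"
proof -
  have "(\<lambda>w. (w, 0)) \<in> hom W D" by (rule homI) simp_all
  then have homs: "q \<circ> (\<lambda>w. (w, 0)) \<in> hom W Q" "toQ \<circ> incl \<in> hom W Q"
    using hom_compose q.homh incl_hom toQ_hom by blast+
  have "(toQ \<circ> incl) w = (q \<circ> (\<lambda>w. (w, 0))) w"
  proof (rule W_hom_eq[OF homs(2,1) Q.is_group _ assms])
    fix i assume "i \<in> {1..n}"
    then obtain j where i: "i = Suc j" by (cases i) auto
    have "toQ (incl (y i)) = toQ (conj_s (Suc j))"
      by (simp add: i incl_y)
    also have "\<dots> = q (toD Gt [^]\<^bsub>D\<^esub> j \<otimes>\<^bsub>D\<^esub> toD Gs \<otimes>\<^bsub>D\<^esub> inv\<^bsub>D\<^esub> (toD Gt [^]\<^bsub>D\<^esub> j))"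
      by (simp only: conj_s_def diff_Suc_1 toQ.hom_mult toQ.hom_inv toQ.hom_nat_pow q.hom_mult q.hom_inv q.hom_nat_pow
        G.m_closed G.nat_pow_closed G.inv_closed stu_closed toQ_gen toD_closed D.m_closed D.nat_pow_closed D.inv_closed)
    also have "toD Gt [^]\<^bsub>D\<^esub> j \<otimes>\<^bsub>D\<^esub> toD Gs \<otimes>\<^bsub>D\<^esub> inv\<^bsub>D\<^esub> (toD Gt [^]\<^bsub>D\<^esub> j) = (y i, 0)"
      unfolding toD.simps tD_pow using delta_conj_y[of j] by (simp add: i W.m_assoc)
    finally show "(toQ \<circ> incl) (y i) = (q \<circ> (\<lambda>w. (w, 0))) (y i)" by simp
  qed
  then show ?thesis by simp
qed

text \<open>Applying \<open>toQ\<close> puts \<open>(w, 0)\<close> and \<open>(\<one>, j)\<close>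
  into the same coset of \<open>C\<close>, so \<open>(w, - j)\<close> lies in \<open>C\<close>. This
  yields both injectivity and the intersection of \<open>W\<close> with the powers of
  \<open>z\<close>.\<close>

lemma incl_eq_z_pow:
  assumes "w \<in> carrier W" "incl w = z [^]\<^bsub>G\<^esub> (j::int)"
  shows "\<exists>i::int. w = c [^]\<^bsub>W\<^esub> i \<and> j = i * int (n * m)"
proof -
  have "zD [^]\<^bsub>D\<^esub> j = (\<one>\<^bsub>W\<^esub>, j)"
    by (cases j rule: int_cases2) (simp_all add: int_pow_int D_pow D.int_pow_neg_int)
  then have *: "q (w, 0) = q (\<one>\<^bsub>W\<^esub>, j)"
    using assms toQ_incl[OF assms(1)] q.hom_int_pow[of zD j] by (simp add: toQ.hom_int_pow toQ_z)
  have "(w, 0) \<otimes>\<^bsub>D\<^esub> inv\<^bsub>D\<^esub> (\<one>\<^bsub>W\<^esub>, j) \<in> C"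
    by (rule D.coset_join1[OF D.coset_mult_inv2[OF *]]) (use assms C.subset C.subgroup_axioms in auto)
  then have "(w, - j) \<in> C" using assms by simp
  then show ?thesis by (auto simp: C_def)
qed


end


section \<open>Injectivity, and \<open>G\<close> as the product of \<open>W\<close> and the powers
  of \<open>z\<close>\<close>

context toric_parameters
begin

lemma incl_inj: "inj_on incl (carrier W)"
proof -
  \<comment> \<open>For exponent 0 the equation \<open>0 = i * (n * m)\<close> forces
    \<open>i = 0\<close>.\<close>
  have "w = \<one>\<^bsub>W\<^esub>" if "w \<in> carrier W" "incl w = \<one>\<^bsub>G\<^esub>" for w
    using incl_eq_z_pow[OF that(1), of 0] that n_pos m_pos by auto
  then show ?thesis
    unfolding incl.inj_on_one_iff by blast
qed

text \<open>These products form a subgroup because \<open>z\<close> is central, and it contains the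
  three generators of \<open>G\<close>.\<close>

lemma G_decomposition:
  assumes "g \<in> carrier G"
  obtains w i where "w \<in> carrier W" "g = incl w \<otimes>\<^bsub>G\<^esub> z [^]\<^bsub>G\<^esub> (i::int)"
proof -
  define K where "K = {incl w \<otimes>\<^bsub>G\<^esub> z [^]\<^bsub>G\<^esub> (i::int) | w i. w \<in> carrier W}"
  have comm: "z [^]\<^bsub>G\<^esub> (i::int) \<otimes>\<^bsub>G\<^esub> g = g \<otimes>\<^bsub>G\<^esub> z [^]\<^bsub>G\<^esub> i" if "g \<in> carrier G" for g i
    using G.center_int_pow[OF z_center, of i] that by (simp add: center_def)
  have K: "subgroup K G"
  proof (rule G.subgroupI)
    show "K \<subseteq> carrier G" "K \<noteq> {}" unfolding K_def by auto
  next
    fix a assume "a \<in> K"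
    then obtain w i where a: "w \<in> carrier W" "a = incl w \<otimes>\<^bsub>G\<^esub> z [^]\<^bsub>G\<^esub> (i::int)" by (auto simp: K_def)
    then have "inv\<^bsub>G\<^esub> a = incl (inv\<^bsub>W\<^esub> w) \<otimes>\<^bsub>G\<^esub> z [^]\<^bsub>G\<^esub> (- i)"
      by (simp add: G.inv_mult_group G.int_pow_neg comm[of _ "- i", unfolded G.int_pow_neg[OF z_closed]])
    then show "inv\<^bsub>G\<^esub> a \<in> K" using a unfolding K_def by blast
  next
    fix a b assume "a \<in> K" "b \<in> K"
    then obtain w i v j where ab: "w \<in> carrier W" "a = incl w \<otimes>\<^bsub>G\<^esub> z [^]\<^bsub>G\<^esub> (i::int)"
      "v \<in> carrier W" "b = incl v \<otimes>\<^bsub>G\<^esub> z [^]\<^bsub>G\<^esub> (j::int)" by (auto simp: K_def)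
    then have "a \<otimes>\<^bsub>G\<^esub> b = incl w \<otimes>\<^bsub>G\<^esub> (z [^]\<^bsub>G\<^esub> i \<otimes>\<^bsub>G\<^esub> incl v) \<otimes>\<^bsub>G\<^esub> z [^]\<^bsub>G\<^esub> j"
      by (simp add: G.m_assoc)
    also have "\<dots> = incl (w \<otimes>\<^bsub>W\<^esub> v) \<otimes>\<^bsub>G\<^esub> z [^]\<^bsub>G\<^esub> (i + j)"
      using ab by (simp add: comm[of "incl v"] G.m_assoc G.int_pow_mult)
    finally show "a \<otimes>\<^bsub>G\<^esub> b \<in> K" using ab unfolding K_def by blast
  qed
  interpret K: subgroup K G by (rule K)
  have inclK: "incl w \<in> K" if "w \<in> carrier W" for w
    unfolding K_def using that by (auto intro!: exI[of _ w] exI[of _ "0::int"])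
  have zK: "z \<in> K"
    unfolding K_def by (auto intro!: exI[of _ "\<one>\<^bsub>W\<^esub>"] exI[of _ "1::int"])
  have powK: "a [^]\<^bsub>G\<^esub> j \<in> K" if "a \<in> K" for a and j :: nat
    using G.subgroup_int_pow_closed[OF K that, of "int j"] by (simp add: int_pow_int)
  have sK: "s \<in> K"
    using inclK[of "y 1"] incl_y[of 1] by (simp add: conj_s_def)
  \<comment> \<open>The image of \<open>\<delta>\<close> supplies the power \<open>m\<close> of
    \<open>t\<close>; since \<open>m\<close> is invertible modulo the exponent \<open>n\<close> of
    \<open>t\<close>, a further power gives \<open>t\<close>.\<close>
  have "t [^]\<^bsub>G\<^esub> m = inv\<^bsub>G\<^esub> (incl \<delta>) \<otimes>\<^bsub>G\<^esub> z [^]\<^bsub>G\<^esub> m"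
    by (simp add: incl_delta G.inv_mult_group G.m_assoc del: incl.hom_inv)
  also have "\<dots> \<in> K" using inclK zK powK by simp
  finally have "(t [^]\<^bsub>G\<^esub> m) [^]\<^bsub>G\<^esub> shift_exp \<in> K" by (rule powK)
  moreover obtain l where l: "m * shift_exp = 1 + n * l" by (rule shift_exp_bezout)
  have "t [^]\<^bsub>G\<^esub> (n * l) = \<one>\<^bsub>G\<^esub>"
    using G.nat_pow_pow[of t n l] by (simp add: J_pow_relations)
  then have "(t [^]\<^bsub>G\<^esub> m) [^]\<^bsub>G\<^esub> shift_exp = t"
    by (simp add: G.nat_pow_pow l)
  ultimately have tK: "t \<in> K" by simp
  have "u = inv\<^bsub>G\<^esub> (s \<otimes>\<^bsub>G\<^esub> t) \<otimes>\<^bsub>G\<^esub> z"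
    by (simp add: z_eq G.inv_mult_group G.m_assoc G.mult_inv_cancel)
  also have "\<dots> \<in> K" using sK tK zK by blast
  finally have uK: "u \<in> K" .
  have "K = carrier G"
    unfolding J_group_def
  proof (rule presented_group_subgroup_eq, fold J_group_def)
    fix x assume "x \<in> J_gens"
    then show "pres_class J_gens (J_rels k n m) (pos [x]) \<in> K"
      using sK tK uK unfolding J_gen_def by (cases x) auto
  qed (rule K)
  then show thesis using assms that unfolding K_def by blast
qed

end


section \<open>Words and lengths in the Coxeter group\<close>

text \<open>The sign of a letter is ignored: generators act as involutions here, at least modulo an
  equivalence relation, so formal inverses act in the same way.\<close>

fun wact :: "('a \<Rightarrow> 'v \<Rightarrow> 'v) \<Rightarrow> 'a word \<Rightarrow> 'v \<Rightarrow> 'v" where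
  "wact f [] v = v"
| "wact f (a # w) v = f (fst a) (wact f w v)"

lemma wact_append [simp]: "wact f (u @ w) v = wact f u (wact f w v)"
  by (induction u) auto

lemma wact_cong:
  assumes "\<And>x v v'. x \<in> S \<Longrightarrow> (v, v') \<in> E \<Longrightarrow> (f x v, f x v') \<in> E" "w \<in> words S" "(v, v') \<in> E"
  shows "(wact f w v, wact f w v') \<in> E"
  using assms(2) by (induction w) (auto simp: assms(1,3))

text \<open>Working modulo an equivalence relation avoids forming the quotient on which the presented
  group acts.\<close>

lemma wact_pres_rel:
  assumes E: "equiv V E"
    and f: "\<And>x v v'. x \<in> S \<Longrightarrow> (v, v') \<in> E \<Longrightarrow> (f x v, f x v') \<in> E"
    and inv: "\<And>x v. x \<in> S \<Longrightarrow> v \<in> V \<Longrightarrow> (f x (f x v), v) \<in> E"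
    and R: "\<And>l r v. (l, r) \<in> R \<Longrightarrow> v \<in> V \<Longrightarrow> (wact f l v, wact f r v) \<in> E"
    and "(w, w') \<in> pres_rel S R" "v \<in> V"
  shows "(wact f w v, wact f w' v) \<in> E"
proof -
  have refl: "(v, v) \<in> E" if "v \<in> V" for v using E that by (auto simp: equiv_def refl_on_def)
  have field: "v \<in> V" if "(v, v') \<in> E" for v v' using E that by (auto simp: equiv_def)
  have cl: "wact f w v \<in> V" if "w \<in> words S" "v \<in> V" for w v
    using field wact_cong[of S E f, OF f that(1) refl[OF that(2)]] by blast
  show ?thesis
    using assms(5,6)
  proof (induction arbitrary: v rule: pres_rel.induct)
    case (refl w)
    then show ?case using cl \<open>\<And>v. v \<in> V \<Longrightarrow> (v, v) \<in> E\<close> by blast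
  next
    case (sym v w)
    then show ?case using E by (auto simp: equiv_def dest: symD)
  next
    case (trans u v w)
    then show ?case using E unfolding equiv_def by (meson transD)
  next
    case (cancel x u w b)
    then have "(wact f u (f x (f x (wact f w v))), wact f u (wact f w v)) \<in> E"
      by (intro wact_cong[of S E f, OF f]) (auto intro: inv cl)
    then show ?case by simp
  next
    case (rel l r u w)
    then have "(wact f u (wact f l (wact f w v)), wact f u (wact f r (wact f w v))) \<in> E"
      by (intro wact_cong[of S E f, OF f]) (auto intro: R cl)
    then show ?case by simp
  qed
qed

lemma words_cox_gens [simp]: "w \<in> words cox_gens"
  by (auto simp: words_def cox_gens_def intro: cgen.exhaust)

locale triangle_group =
  fixes k n m :: nat
  assumes k2: "k \<ge> 2" and n2: "n \<ge> 2" and m2: "m \<ge> 2"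
begin

abbreviation H where "H \<equiv> cox_group k n m"
definition cls :: "cgen word \<Rightarrow> cgen word set" where
  "cls = pres_class cox_gens (cox_rels k n m)"

abbreviation r where "r x \<equiv> cls [(x, True)]"
abbreviation L where "L \<equiv> cox_length"

sublocale H: group H
  unfolding cox_group_def by (rule group_presented_group)

lemma carrier_H: "carrier H = range cls"
  by (auto simp: cox_group_def cls_def carrier_presented_group)

lemma cls_closed [simp]: "cls w \<in> carrier H"
  by (simp add: carrier_H)

lemma cls_append: "cls (v @ w) = cls v \<otimes>\<^bsub>H\<^esub> cls w"
  by (simp add: cox_group_def cls_def mult_presented_group)

lemma cls_Nil: "cls [] = \<one>\<^bsub>H\<^esub>"
  by (simp add: cox_group_def cls_def one_presented_group)

lemma cls_eq_iff: "cls v = cls w \<longleftrightarrow> (v, w) \<in> pres_rel cox_gens (cox_rels k n m)"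
  by (simp add: cls_def pres_class_eq_iff)

lemma cls_rel: "(l, l') \<in> cox_rels k n m \<Longrightarrow> cls l = cls l'"
  unfolding cls_def by (rule pres_class_rel) auto

lemma r_r [simp]: "r x \<otimes>\<^bsub>H\<^esub> r x = \<one>\<^bsub>H\<^esub>"
proof -
  have "cls (wpow 2 (pos [x])) = cls []"
    by (intro cls_rel) (cases x; simp add: cox_rels_def)
  then show ?thesis
    using cls_append[of "[(x, True)]" "[(x, True)]"] by (simp add: numeral_2_eq_2 cls_Nil)
qed

lemma r_cancel [simp]: "g \<in> carrier H \<Longrightarrow> g \<otimes>\<^bsub>H\<^esub> r x \<otimes>\<^bsub>H\<^esub> r x = g"
  using r_r by (metis H.m_assoc H.r_one cls_closed)

lemma r_inv: "inv\<^bsub>H\<^esub> r x = r x"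
  by (rule H.inv_equality) (simp_all only: r_r cls_closed)

lemma cls_letter: "cls [(x, b)] = r x"
  using pres_class_inverse_letter[of x cox_gens "cox_rels k n m"] r_inv[of x]
  by (cases b; cases x) (simp_all add: cox_group_def cls_def cox_gens_def)

text \<open>The Coxeter matrix.\<close>

fun mm :: "cgen \<Rightarrow> cgen \<Rightarrow> nat" where
  "mm R1 R2 = k" | "mm R2 R1 = k" | "mm R2 R3 = n" | "mm R3 R2 = n" | "mm R3 R1 = m" | "mm R1 R3 = m"
| "mm R1 R1 = 1" | "mm R2 R2 = 1" | "mm R3 R3 = 1"

lemma mm_sym: "mm x y = mm y x"
  by (cases x; cases y) auto

lemma mm_ge_2: "x \<noteq> y \<Longrightarrow> mm x y \<ge> 2"
  using k2 n2 m2 by (cases x; cases y) auto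

lemma rr_pow:
  assumes "x \<noteq> y"
  shows "(r x \<otimes>\<^bsub>H\<^esub> r y) [^]\<^bsub>H\<^esub> mm x y = \<one>\<^bsub>H\<^esub>"
proof -
  have *: "cls (wpow j (pos [x, y])) = (r x \<otimes>\<^bsub>H\<^esub> r y) [^]\<^bsub>H\<^esub> j" for x y j
    using pres_class_wpow[of "pos [x, y]" cox_gens "cox_rels k n m" j]
      cls_append[of "pos [x]" "pos [y]"] by (simp add: cox_group_def cls_def)
  have rel: "(r R1 \<otimes>\<^bsub>H\<^esub> r R2) [^]\<^bsub>H\<^esub> k = \<one>\<^bsub>H\<^esub>" "(r R2 \<otimes>\<^bsub>H\<^esub> r R3) [^]\<^bsub>H\<^esub> n = \<one>\<^bsub>H\<^esub>"
    "(r R3 \<otimes>\<^bsub>H\<^esub> r R1) [^]\<^bsub>H\<^esub> m = \<one>\<^bsub>H\<^esub>"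
    unfolding *[symmetric] cls_Nil[symmetric] by (intro cls_rel; simp add: cox_rels_def)+
  have inv: "(r y \<otimes>\<^bsub>H\<^esub> r x) [^]\<^bsub>H\<^esub> j = \<one>\<^bsub>H\<^esub>" if "(r x \<otimes>\<^bsub>H\<^esub> r y) [^]\<^bsub>H\<^esub> j = \<one>\<^bsub>H\<^esub>" for x y and j :: nat
  proof -
    have "r y \<otimes>\<^bsub>H\<^esub> r x = inv\<^bsub>H\<^esub> (r x \<otimes>\<^bsub>H\<^esub> r y)"
      by (simp only: H.inv_mult_group cls_closed r_inv)
    then show ?thesis using that by (simp only: H.nat_pow_inv H.m_closed cls_closed H.inv_one)
  qed
  show ?thesis
    using assms rel inv by (cases x; cases y) simp_all
qed

text \<open>Let every generator negate a truth value. All relators have even length, so this is an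
  action, and it detects the parity of a word.\<close>

lemma even_length_cls:
  assumes "cls v = cls w" shows "even (length v) = even (length w)"
proof -
  have w: "wact (\<lambda>_ :: cgen. Not) w b = (b \<noteq> odd (length w))" for w b
    by (induction w) auto
  have p: "length (wpow j w) = j * length w" for j and w :: "cgen word"
    by (induction j) auto
  have "(wact (\<lambda>_ :: cgen. Not) v True, wact (\<lambda>_. Not) w True) \<in> Id"
  proof (rule wact_pres_rel[of UNIV])
    show "(v, w) \<in> pres_rel cox_gens (cox_rels k n m)" using assms by (simp add: cls_eq_iff)
    show "equiv UNIV (Id :: bool rel)" by (simp add: equiv_def refl_on_def sym_Id trans_Id)
  qed (auto simp: w cox_rels_def p pos_def)
  then show ?thesis by (simp add: w)
qed

lemma L_le: "L (cls w) \<le> length w"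
  unfolding cox_length_def by (rule Least_le) (auto simp: cls_def pres_class_def intro!: bexI[of _ w] pres_rel.refl)

lemma L_attained:
  assumes "g \<in> carrier H"
  obtains w where "g = cls w" "length w = L g"
proof -
  obtain w0 where w0: "g = cls w0" using assms by (auto simp: carrier_H)
  then have "w0 \<in> g" by (simp add: cls_def pres_class_def pres_rel.refl)
  then have "\<exists>l. \<exists>w\<in>g. length w = l" by blast
  then have "\<exists>w\<in>g. length w = L g" unfolding cox_length_def by (rule LeastI_ex)
  then obtain w where "w \<in> g" "length w = L g" by blast
  moreover have "cls w0 = cls w" using \<open>w \<in> g\<close> unfolding w0 cls_eq_iff by (simp add: cls_def pres_class_def)
  ultimately show thesis using that w0 by simp
qed

lemma even_L: "even (L (cls w)) = even (length w)"
  by (metis L_attained cls_closed even_length_cls)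

lemma L_mult_r: "g \<in> carrier H \<Longrightarrow> L (g \<otimes>\<^bsub>H\<^esub> r x) \<le> L g + 1"
  by (elim L_attained) (metis L_le cls_append length_append length_Cons list.size(3) pos_simps(1,2) One_nat_def)

lemma L_mult_r': "g \<in> carrier H \<Longrightarrow> L g \<le> L (g \<otimes>\<^bsub>H\<^esub> r x) + 1"
  using L_mult_r[of "g \<otimes>\<^bsub>H\<^esub> r x" x] by simp

lemma L_eq_0: "g \<in> carrier H \<Longrightarrow> L g = 0 \<Longrightarrow> g = \<one>\<^bsub>H\<^esub>"
  by (elim L_attained) (simp add: cls_Nil)

lemma L_descent:
  assumes "g \<in> carrier H" "L g \<noteq> 0"
  obtains x where "L (g \<otimes>\<^bsub>H\<^esub> r x) < L g"
proof -
  obtain w where w: "g = cls w" "length w = L g" by (rule L_attained[OF assms(1)])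
  then have "w \<noteq> []" using assms(2) by auto
  then obtain v x b where v: "w = v @ [(x, b)]" by (metis rev_exhaust surj_pair)
  then have "g = cls v \<otimes>\<^bsub>H\<^esub> r x" using w cls_append[of v "[(x, b)]"] cls_letter[of x b] by simp
  then have "g \<otimes>\<^bsub>H\<^esub> r x = cls v" by (simp only: r_cancel cls_closed)
  then have "L (g \<otimes>\<^bsub>H\<^esub> r x) < L g" using L_le[of v] v w by simp
  then show thesis by (rule that)
qed

section \<open>Alternating products and the braid relation\<close>

definition alt_letter :: "cgen \<Rightarrow> cgen \<Rightarrow> nat \<Rightarrow> cgen" where
  "alt_letter x y j = (if even j then x else y)"

fun alt_prod :: "cgen \<Rightarrow> cgen \<Rightarrow> nat \<Rightarrow> cgen word set" where
  "alt_prod x y 0 = \<one>\<^bsub>H\<^esub>"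
| "alt_prod x y (Suc j) = alt_prod x y j \<otimes>\<^bsub>H\<^esub> r (alt_letter x y j)"

lemma alt_prod_closed [simp]: "alt_prod x y j \<in> carrier H"
  by (induction j) (simp_all del: pos_simps)

lemma alt_prod_even: "alt_prod x y (2 * j) = (r x \<otimes>\<^bsub>H\<^esub> r y) [^]\<^bsub>H\<^esub> j"
  by (induction j) (simp_all add: alt_letter_def H.m_assoc)

text \<open>The alternating product of length \<open>2 * mm x y\<close> is trivial. Removing
  \<open>i\<close> letters from its right end leaves their product in reverse order, which starts
  with \<open>y\<close>. The case \<open>i = mm x y\<close> is the braid relation.\<close>

lemma alt_prod_reverse:
  assumes "x \<noteq> y" "i \<le> 2 * mm x y"
  shows "alt_prod x y (2 * mm x y - i) = alt_prod y x i"
  using assms(2)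
proof (induction i)
  case 0
  then show ?case using rr_pow[OF assms(1)] by (simp add: alt_prod_even del: pos_simps)
next
  case (Suc i)
  let ?M = "2 * mm x y"
  have "?M - i = Suc (?M - Suc i)" using Suc.prems by simp
  then have "alt_prod x y (?M - i) = alt_prod x y (?M - Suc i) \<otimes>\<^bsub>H\<^esub> r (alt_letter x y (?M - Suc i))"
    by (simp del: pos_simps)
  moreover have "alt_letter x y (?M - Suc i) = alt_letter y x i"
    using Suc.prems by (auto simp: alt_letter_def)
  ultimately have "alt_prod y x i \<otimes>\<^bsub>H\<^esub> r (alt_letter y x i) = alt_prod x y (?M - Suc i)"
    using Suc by (metis alt_prod_closed Suc_leD r_cancel)
  then show ?case by simp
qed

lemma alt_prod_braid: "x \<noteq> y \<Longrightarrow> alt_prod x y (mm x y) = alt_prod y x (mm x y)"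
  using alt_prod_reverse[of x y "mm x y"] by (simp add: mult_2)

lemma L_mult_alt_prod: "g \<in> carrier H \<Longrightarrow> L (g \<otimes>\<^bsub>H\<^esub> alt_prod x y i) \<le> L (g \<otimes>\<^bsub>H\<^esub> alt_prod x y (i + j)) + j"
proof (induction j)
  case (Suc j)
  have "L (g \<otimes>\<^bsub>H\<^esub> alt_prod x y (i + j)) \<le> L (g \<otimes>\<^bsub>H\<^esub> alt_prod x y (i + Suc j)) + 1"
    using L_mult_r'[of "g \<otimes>\<^bsub>H\<^esub> alt_prod x y (i + j)"] Suc.prems by (simp add: H.m_assoc del: pos_simps)
  then show ?case using Suc by simp
qed simp

end


section \<open>The geometric representation\<close>

lemma cgen_third: "x \<noteq> y \<Longrightarrow> \<exists>z. z \<noteq> x \<and> z \<noteq> (y :: cgen)"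
  by (cases x; cases y) auto

lemma cgen_cases3:
  assumes "x \<noteq> y" "z \<noteq> x" "z \<noteq> (y :: cgen)"
  shows "i = x \<or> i = y \<or> i = z"
  using assms by (cases x; cases y; cases z; cases i) auto

context triangle_group
begin

text \<open>The negative of the Tits form on the simple roots; the value \<open>- 1\<close> on the
  diagonal says that roots have norm 1.\<close>

definition cs :: "cgen \<Rightarrow> cgen \<Rightarrow> real" where
  "cs x y = (if x = y then - 1 else cos (pi / mm x y))"

lemma cs_sym: "cs x y = cs y x"
  by (simp add: cs_def mm_sym)

lemma angle:
  assumes "x \<noteq> y"
  shows "0 < pi / mm x y" "pi / mm x y \<le> pi / 2" "mm x y * (pi / mm x y) = pi" "sin (pi / mm x y) > 0"
proof -
  have mm: "mm x y \<ge> 2" by (rule mm_ge_2[OF assms])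
  then show 1: "0 < pi / mm x y" "mm x y * (pi / mm x y) = pi" by auto
  show 2: "pi / mm x y \<le> pi / 2"
    using mm by (intro divide_left_mono) auto
  show "sin (pi / mm x y) > 0"
    using 1 2 by (intro sin_gt_zero) (use pi_gt_zero in linarith)+
qed

lemma cs_square_less: "x \<noteq> y \<Longrightarrow> (cs x y)\<^sup>2 < 1"
  using angle(4)[of x y] by (simp add: cs_def cos_squared_eq)

lemma cs_zero_iff:
  assumes "x \<noteq> y" shows "cs x y = 0 \<longleftrightarrow> mm x y = 2"
proof
  assume "cs x y = 0"
  show "mm x y = 2"
  proof (rule ccontr)
    assume "mm x y \<noteq> 2"
    then have "mm x y > 2" using mm_ge_2[OF assms] by simp
    then have "pi / mm x y < pi / 2" by (intro divide_strict_left_mono) auto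
    then have "cos (pi / mm x y) > 0" using angle(1)[OF assms] by (intro cos_gt_zero) auto
    then show False using \<open>cs x y = 0\<close> assms by (simp add: cs_def)
  qed
qed (use assms in \<open>simp add: cs_def\<close>)

text \<open>The reflection in the simple root \<open>x\<close>, in coordinates with respect to the
  simple roots: only the coordinate at \<open>x\<close> changes.\<close>

definition mirror :: "cgen \<Rightarrow> (cgen \<Rightarrow> real) \<Rightarrow> cgen \<Rightarrow> real" where
  "mirror x v = v(x := v x + 2 * (v R1 * cs R1 x + v R2 * cs R2 x + v R3 * cs R3 x))"

lemma mirror_other [simp]: "i \<noteq> x \<Longrightarrow> mirror x v i = v i"
  by (simp add: mirror_def)

lemma mirror_same:
  assumes "x \<noteq> y" "z \<noteq> x" "z \<noteq> y"
  shows "mirror x v x = - v x + 2 * cs x y * v y + 2 * cs x z * v z"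
  using assms cs_sym by (cases x; cases y; cases z) (simp_all add: mirror_def cs_def mm_sym algebra_simps)

lemma mirror_refl [simp]: "mirror x (mirror x v) = v"
proof -
  have "cs x x = -1" by (simp add: cs_def)
  then show ?thesis
    by (cases x) (auto simp: mirror_def fun_eq_iff algebra_simps)
qed

lemma mirror_linear: "mirror x (\<lambda>i. p * v i + q * w i) = (\<lambda>i. p * mirror x v i + q * mirror x w i)"
  by (auto simp: mirror_def fun_eq_iff algebra_simps)

lemma wact_wpow_2: "wact f (wpow 2 (pos [x])) v = f x (f x v)"
  by (simp add: numeral_2_eq_2)

text \<open>Every sinusoid satisfies the recurrence that two mirrors applied in turn impose on the
  coordinates.\<close>

lemma sin_cos_step:
  fixes p q th ph :: real
  shows "2 * cos th * (p * cos ph + q * sin ph) - (p * cos (ph + th) + q * sin (ph + th))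
    = p * cos (ph - th) + q * sin (ph - th)"
  by (simp add: cos_add cos_diff sin_add sin_diff algebra_simps)

text \<open>In the plane spanned by the coordinates \<open>x\<close> and \<open>y\<close>, shifted to the fixed point of both
  mirrorections, \<open>mirror x \<circ> mirror y\<close> is a rotation by \<open>2 \<pi> / mm x y\<close>.\<close>

lemma mirror_rotation:
  assumes "x \<noteq> y"
  shows "wact mirror (wpow (mm x y) (pos [x, y])) v = v"
proof -
  obtain z where z: "z \<noteq> x" "z \<noteq> y" using cgen_third[OF assms] by blast
  define th where "th = pi / mm x y"
  define a where "a = cs x y"
  define D where "D = 1 - a\<^sup>2"
  have D: "D \<noteq> 0" using cs_square_less[OF assms] by (simp add: D_def a_def)
  \<comment> \<open>\<open>(p0, q0)\<close> is the common fixed point of both mirrors for the given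
    coordinate \<open>v z\<close>. It solves a linear system with determinant \<open>D\<close>,
    which is nonzero because the cosine is less than 1 in absolute value.\<close>
  define p0 where "p0 = (cs x z + a * cs y z) * v z / D"
  define q0 where "q0 = (cs y z + a * cs x z) * v z / D"
  have p0: "a * q0 + cs x z * v z = p0" and q0: "a * p0 + cs y z * v z = q0"
    using D by (simp_all add: p0_def q0_def field_simps) (simp_all add: D_def algebra_simps power2_eq_square)
  have cth: "cos th = a" using assms by (simp add: th_def a_def cs_def)
  have sth: "sin th \<noteq> 0" using angle(4)[OF assms] by (simp add: th_def)
  \<comment> \<open>The amplitudes are chosen so that \<open>g 0\<close> and \<open>g th\<close> are
    the offsets of \<open>v\<close> from the fixed point, that is, \<open>st 0 = v\<close>.\<close>
  define b1 where "b1 = v x - p0"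
  define b2 where "b2 = (v y - q0 - b1 * cos th) / sin th"
  define g where "g ph = b1 * cos ph + b2 * sin ph" for ph
  \<comment> \<open>The two offsets sample \<open>g\<close> at \<open>ph\<close> and
    \<open>ph + th\<close>. By \<open>g_step\<close>, \<open>mirror y\<close> replaces the second
    phase by \<open>ph - th\<close>, then \<open>mirror x\<close> replaces the first by
    \<open>ph - 2 * th\<close>. After \<open>mm x y\<close> rounds the phase has moved by
    \<open>2 * pi\<close>.\<close>
  define st where "st ph = v(x := p0 + g ph, y := q0 + g (ph + th))" for ph
  have g_step: "2 * a * g ph - g (ph + th) = g (ph - th)" for ph
    unfolding g_def cth[symmetric] by (rule sin_cos_step)
  have step: "mirror x (mirror y (st ph)) = st (ph - 2 * th)" for ph
  proof -
    have st: "st ph x = p0 + g ph" "st ph y = q0 + g (ph + th)" "st ph z = v z"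
      using assms z by (simp_all add: st_def)
    have 1: "mirror y (st ph) y = q0 + g (ph - th)"
    proof -
      have "mirror y (st ph) y = - st ph y + 2 * a * st ph x + 2 * cs y z * st ph z"
        using mirror_same[of y x z "st ph"] assms z cs_sym[of y x] by (simp add: a_def)
      also have "\<dots> = 2 * (a * p0 + cs y z * v z) - q0 + (2 * a * g ph - g (ph + th))"
        unfolding st by (simp add: algebra_simps)
      finally show ?thesis unfolding q0 g_step by simp
    qed
    have "mirror x (mirror y (st ph)) x = - st ph x + 2 * a * (q0 + g (ph - th)) + 2 * cs x z * v z"
      using mirror_same[OF assms z, of "mirror y (st ph)"] assms z st 1 by (simp add: a_def)
    also have "\<dots> = 2 * (a * q0 + cs x z * v z) - p0 + (2 * a * g (ph - th) - g (ph - th + th))"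
      unfolding st by (simp add: algebra_simps)
    finally have 2: "mirror x (mirror y (st ph)) x = p0 + g (ph - 2 * th)"
      unfolding p0 g_step by (simp add: algebra_simps)
    show ?thesis
    proof
      fix i
      consider "i = x" | "i = y" | "i = z" using cgen_cases3[OF assms z] by blast
      then show "mirror x (mirror y (st ph)) i = st (ph - 2 * th) i"
        by cases (use assms z st 1 2 in \<open>auto simp: st_def\<close>)
    qed
  qed
  have "wact mirror (wpow j (pos [x, y])) (st ph) = st (ph - 2 * real j * th)" for j ph
    by (induction j) (simp_all add: step algebra_simps)
  then have "wact mirror (wpow (mm x y) (pos [x, y])) (st 0) = st (- (2 * pi))"
    using angle(3)[OF assms] by (simp only: th_def mult.assoc) simp
  moreover have "st (- (2 * pi)) = st 0"
  proof -
    have "g (ph - 2 * pi) = g ph" for ph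
      by (simp add: g_def cos_diff sin_diff)
    from this[of 0] this[of th] show ?thesis by (simp add: st_def add.commute)
  qed
  moreover have "st 0 = v"
    using sth by (simp add: st_def g_def b1_def b2_def fun_eq_iff)
  ultimately show ?thesis by simp
qed

section \<open>The representation of the Coxeter group and the positivity of roots\<close>

lemma wact_refl_cox_rels:
  assumes "(l, l') \<in> cox_rels k n m"
  shows "wact mirror l v = wact mirror l' v"
  using assms wact_wpow_2[of mirror] mirror_rotation[of R1 R2] mirror_rotation[of R2 R3] mirror_rotation[of R3 R1]
  by (auto simp: cox_rels_def simp del: wpow_simps)

text \<open>Independence of the chosen word follows from the relations among the mirrors, see
  \<open>\<rho>_cls\<close>.\<close>

definition \<rho> :: "cgen word set \<Rightarrow> (cgen \<Rightarrow> real) \<Rightarrow> cgen \<Rightarrow> real" where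
  "\<rho> g = wact mirror (SOME w. cls w = g)"

lemma \<rho>_cls: "\<rho> (cls w) = wact mirror w"
proof
  fix v
  have "cls (SOME w'. cls w' = cls w) = cls w" by (rule someI) (rule HOL.refl)
  then have "(wact mirror (SOME w'. cls w' = cls w) v, wact mirror w v) \<in> Id"
    unfolding cls_eq_iff
    by (rule wact_pres_rel[where V = UNIV, rotated -2])
      (auto simp: equiv_def refl_on_def sym_Id trans_Id wact_refl_cox_rels)
  then show "\<rho> (cls w) v = wact mirror w v" by (simp add: \<rho>_def)
qed

lemma \<rho>_mult: "g \<in> carrier H \<Longrightarrow> h \<in> carrier H \<Longrightarrow> \<rho> (g \<otimes>\<^bsub>H\<^esub> h) v = \<rho> g (\<rho> h v)"
  by (auto simp: carrier_H \<rho>_cls simp flip: cls_append)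

lemma \<rho>_one [simp]: "\<rho> \<one>\<^bsub>H\<^esub> v = v"
  by (simp add: \<rho>_cls flip: cls_Nil)

lemma \<rho>_r [simp]: "\<rho> (r x) v = mirror x v"
  by (simp add: \<rho>_cls)

lemma \<rho>_linear:
  assumes "g \<in> carrier H"
  shows "\<rho> g (\<lambda>i. p * v i + q * w i) = (\<lambda>i. p * \<rho> g v i + q * \<rho> g w i)"
proof -
  have "wact mirror u (\<lambda>i. p * v i + q * w i) = (\<lambda>i. p * wact mirror u v i + q * wact mirror u w i)" for u
    by (induction u) (auto simp: mirror_linear)
  then show ?thesis using assms by (auto simp: carrier_H \<rho>_cls)
qed

text \<open>The simple roots.\<close>

definition \<alpha> :: "cgen \<Rightarrow> cgen \<Rightarrow> real" where
  "\<alpha> x = (\<lambda>i. if i = x then 1 else 0)"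

lemma \<alpha>_simps [simp]: "\<alpha> x x = 1" "i \<noteq> x \<Longrightarrow> \<alpha> x i = 0"
  by (simp_all add: \<alpha>_def)

lemma mirror_\<alpha>:
  assumes "x \<noteq> y"
  shows "mirror x (\<lambda>i. p * \<alpha> x i + q * \<alpha> y i) = (\<lambda>i. (2 * cs x y * q - p) * \<alpha> x i + q * \<alpha> y i)"
proof
  fix i
  obtain z where z: "z \<noteq> x" "z \<noteq> y" using cgen_third[OF assms] by blast
  then show "mirror x (\<lambda>i. p * \<alpha> x i + q * \<alpha> y i) i = (2 * cs x y * q - p) * \<alpha> x i + q * \<alpha> y i"
    using mirror_same[OF assms z] assms by (cases "i = x") auto
qed

text \<open>Values of Chebyshev polynomials of the second kind. They are the coefficients of the
  roots in the rank two subsystem spanned by \<open>x\<close> and \<open>y\<close>.\<close>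

definition sin_quot :: "cgen \<Rightarrow> cgen \<Rightarrow> nat \<Rightarrow> real" where
  "sin_quot x y j = sin (j * (pi / mm x y)) / sin (pi / mm x y)"

lemma sin_quot_rec:
  assumes "x \<noteq> y"
  shows "sin_quot x y (Suc (Suc j)) = 2 * cs x y * sin_quot x y (Suc j) - sin_quot x y j"
proof -
  define th where "th = pi / mm x y"
  have cs: "cs x y = cos th" using assms by (simp add: cs_def th_def)
  have "sin (real (Suc (Suc j)) * th) = 2 * cos th * sin (real (Suc j) * th) - sin (real j * th)"
    using sin_add[of "real (Suc j) * th" th] sin_diff[of "real (Suc j) * th" th]
    by (simp add: algebra_simps)
  then show ?thesis
    unfolding sin_quot_def th_def[symmetric] cs by (simp add: diff_divide_distrib)
qed

lemma sin_quot_nonneg: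
  assumes "x \<noteq> y" "j \<le> mm x y"
  shows "sin_quot x y j \<ge> 0"
proof -
  have "real j * (pi / mm x y) \<le> mm x y * (pi / mm x y)"
    using assms angle(1)[of x y] by (intro mult_right_mono) auto
  then have "sin (real j * (pi / mm x y)) \<ge> 0"
    using angle(1,3)[OF assms(1)] by (intro sin_ge_zero) auto
  then show ?thesis using angle(4)[OF assms(1)] by (simp add: sin_quot_def)
qed

text \<open>Each step transfers one generator from the vector to the group element. The three-term
  recurrence \<open>sin_quot_rec\<close> describes exactly how a mirror changes the
  coefficients.\<close>

lemma \<rho>_alternating:
  assumes "g \<in> carrier H" "x \<noteq> y"
  shows "\<rho> g (\<alpha> y) = \<rho> (g \<otimes>\<^bsub>H\<^esub> alt_prod x y j)
    (\<lambda>i. sin_quot x y j * \<alpha> (alt_letter x y j) i + sin_quot x y (Suc j) * \<alpha> (alt_letter x y (Suc j)) i)"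
proof (induction j)
  case 0
  then show ?case using assms angle(4)[of x y] by (simp add: sin_quot_def alt_letter_def)
next
  case (Suc j)
  let ?a = "alt_letter x y j" and ?b = "alt_letter x y (Suc j)"
  have ab: "?a \<noteq> ?b" "cs ?a ?b = cs x y" "alt_letter x y (Suc (Suc j)) = ?a"
    using assms(2) cs_sym by (auto simp: alt_letter_def)
  have "\<rho> (g \<otimes>\<^bsub>H\<^esub> alt_prod x y j) v = \<rho> (g \<otimes>\<^bsub>H\<^esub> alt_prod x y (Suc j)) (mirror ?a v)" for v
    using assms(1) by (simp add: \<rho>_mult)
  then show ?case
    unfolding Suc.IH by (simp add: mirror_\<alpha> ab sin_quot_rec[OF assms(2)] add.commute)
qed

text \<open>Strip letters \<open>x, y, x, \<dots>\<close> from the right end of \<open>g\<close> for as long as the length drops.  By the braid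
  relation this stops before \<open>mm x y\<close> steps, and what is left sends both \<open>\<alpha> x\<close> and \<open>\<alpha> y\<close> to nonnegative
  vectors by induction.\<close>

lemma \<rho>_nonneg:
  assumes "g \<in> carrier H" "L g \<le> L (g \<otimes>\<^bsub>H\<^esub> r y)"
  shows "\<rho> g (\<alpha> y) i \<ge> 0"
  using assms
proof (induction "L g" arbitrary: g y i rule: less_induct)
  case less
  show ?case
  proof (cases "L g = 0")
    case True
    then have "g = \<one>\<^bsub>H\<^esub>" using L_eq_0 less.prems by blast
    then show ?thesis by (simp add: \<alpha>_def)
  next
    case False
    then obtain x where x: "L (g \<otimes>\<^bsub>H\<^esub> r x) < L g" using L_descent less.prems by blast
    then have xy: "x \<noteq> y" using less.prems by auto
    let ?M = "mm x y" and ?w = "\<lambda>j. g \<otimes>\<^bsub>H\<^esub> alt_prod x y j"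
    have w_Suc: "?w (Suc j) = ?w j \<otimes>\<^bsub>H\<^esub> r (alt_letter x y j)" for j
      using less.prems by (simp add: H.m_assoc)
    have "\<exists>j. \<not> L (?w (Suc j)) < L (?w j) \<and> j < ?M"
    proof (rule ccontr)
      assume "\<not> ?thesis"
      then have *: "L (?w (Suc j)) < L (?w j)" if "j < ?M" for j using that by blast
      have "L (?w j) + j \<le> L g" if "j \<le> ?M" for j
        using that
      proof (induction j)
        case (Suc j)
        then show ?case using *[of j] by simp
      qed (use less.prems in simp)
      \<comment> \<open>If all \<open>?M\<close> steps were descents, the braid relation would let
        the stripped product start with \<open>y\<close> instead. Restoring all but this first
        letter costs at most \<open>?M - 1\<close> in length, so \<open>y\<close> would be a descent
        of \<open>g\<close>.\<close>
      from this[of ?M] have "L (g \<otimes>\<^bsub>H\<^esub> alt_prod y x ?M) + ?M \<le> L g"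
        using alt_prod_braid[OF xy] by simp
      moreover have "L (g \<otimes>\<^bsub>H\<^esub> r y) \<le> L (g \<otimes>\<^bsub>H\<^esub> alt_prod y x ?M) + (?M - 1)"
        using L_mult_alt_prod[OF less.prems(1), of y x 1 "?M - 1"] mm_ge_2[OF xy] by (simp add: alt_letter_def)
      ultimately show False using less.prems(2) mm_ge_2[OF xy] by linarith
    qed
    \<comment> \<open>Take the least such \<open>j\<close>, so that every earlier step is a
      descent.\<close>
    then obtain j where j: "\<not> L (?w (Suc j)) < L (?w j) \<and> j < ?M"
      and below: "\<And>i. i < j \<Longrightarrow> \<not> (\<not> L (?w (Suc i)) < L (?w i) \<and> i < ?M)"
      using exists_least_iff[of "\<lambda>j. \<not> L (?w (Suc j)) < L (?w j) \<and> j < ?M"] by blast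
    have "j \<noteq> 0"
      using j x less.prems by (cases j) (auto simp: alt_letter_def)
    then obtain j' where j': "j = Suc j'" by (cases j) auto
    have desc: "L (?w (Suc i)) < L (?w i)" if "i < j" for i
      using below[OF that] j that by simp
    have "L (?w i) + i \<le> L g" if "i \<le> j" for i
      using that
    proof (induction i)
      case (Suc i)
      then show ?case using desc[of i] by simp
    qed (use less.prems in simp)
    from this[of j] have lt: "L (?w j) < L g" using \<open>j \<noteq> 0\<close> by simp
    have cl: "?w j \<in> carrier H" using less.prems by simp
    have 1: "\<rho> (?w j) (\<alpha> (alt_letter x y j)) i \<ge> 0" for i
      by (rule less.hyps[OF lt cl]) (use j w_Suc in simp)
    \<comment> \<open>The letter after next is the one stripped last. Multiplying by it undoes that
      descent, so it increases the length and the induction hypothesis applies.\<close>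
    have "?w j \<otimes>\<^bsub>H\<^esub> r (alt_letter x y (Suc j)) = ?w j'"
    proof -
      have "alt_letter x y (Suc j) = alt_letter x y j'" by (simp add: alt_letter_def j')
      then show ?thesis using w_Suc[of j'] less.prems by (simp add: j' del: alt_prod.simps)
    qed
    then have 2: "\<rho> (?w j) (\<alpha> (alt_letter x y (Suc j))) i \<ge> 0" for i
      by (intro less.hyps[OF lt cl]) (use desc[of j'] j' in simp)
    show ?thesis
      unfolding \<rho>_alternating[OF less.prems(1) xy, of j] \<rho>_linear[OF cl]
      using 1 2 sin_quot_nonneg[OF xy, of j] sin_quot_nonneg[OF xy, of "Suc j"] j by (intro add_nonneg_nonneg mult_nonneg_nonneg) auto
  qed
qed

text \<open>A nontrivial \<open>g\<close> has a right descent \<open>x\<close>, and positivity for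
  \<open>g \<otimes> r x\<close> makes the image of \<open>\<alpha> x\<close> under \<open>g\<close>
  nonpositive. Being also nonnegative, this image is zero, which contradicts invertibility.\<close>

lemma \<rho>_faithful:
  assumes "g \<in> carrier H" "\<And>x i. \<rho> g (\<alpha> x) i \<ge> 0"
  shows "g = \<one>\<^bsub>H\<^esub>"
proof (rule ccontr)
  assume "g \<noteq> \<one>\<^bsub>H\<^esub>"
  then have "L g \<noteq> 0" using L_eq_0 assms(1) by blast
  then obtain x where x: "L (g \<otimes>\<^bsub>H\<^esub> r x) < L g" using L_descent assms(1) by blast
  let ?h = "g \<otimes>\<^bsub>H\<^esub> r x"
  have "\<rho> ?h (\<alpha> x) i \<ge> 0" for i
    by (rule \<rho>_nonneg) (use assms(1) x in simp_all)
  moreover have "mirror x (\<alpha> x) = (\<lambda>i. (-1) * \<alpha> x i + 0 * \<alpha> x i)"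
  proof -
    obtain y where "x \<noteq> y" by (cases x) auto
    from mirror_\<alpha>[OF this, of 1 0] show ?thesis by simp
  qed
  then have "\<rho> ?h (\<alpha> x) = (\<lambda>i. - \<rho> g (\<alpha> x) i)"
    using \<rho>_linear[OF assms(1), of "-1" "\<alpha> x" 0 "\<alpha> x"] assms(1) by (simp add: \<rho>_mult)
  ultimately have "\<rho> g (\<alpha> x) i = 0" for i
    using assms(2)[of x i] by (metis neg_0_le_iff_le order_antisym)
  then have zero: "\<rho> g (\<alpha> x) = (\<lambda>i. 0 * \<alpha> x i + 0 * \<alpha> x i)" by auto
  have "\<alpha> x = \<rho> (inv\<^bsub>H\<^esub> g) (\<rho> g (\<alpha> x))"
    using assms(1) by (simp flip: \<rho>_mult)
  also have "\<dots> = (\<lambda>i. 0)"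
    unfolding zero using assms(1) by (subst \<rho>_linear) auto
  finally show False by (metis \<alpha>_simps(1) zero_neq_one)
qed

end


section \<open>The centre of the alternating subgroup\<close>

context triangle_group
begin

lemma \<rho>_mult2: "g \<in> carrier H \<Longrightarrow> \<rho> (g \<otimes>\<^bsub>H\<^esub> (r x \<otimes>\<^bsub>H\<^esub> r y)) v = \<rho> g (mirror x (mirror y v))"
  "g \<in> carrier H \<Longrightarrow> \<rho> (r x \<otimes>\<^bsub>H\<^esub> r y \<otimes>\<^bsub>H\<^esub> g) v = mirror x (mirror y (\<rho> g v))"
  by (simp_all add: \<rho>_mult)

lemma mirror_\<alpha>_same: "mirror x (\<alpha> x) = (\<lambda>i. (-1) * \<alpha> x i + 0 * \<alpha> x i)"
proof -
  obtain y where "x \<noteq> y" by (cases x) auto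
  from mirror_\<alpha>[OF this, of 1 0] show ?thesis by simp
qed

lemma mirror_\<alpha>_other: "x \<noteq> y \<Longrightarrow> mirror x (\<alpha> y) = (\<lambda>i. (2 * cs x y) * \<alpha> x i + 1 * \<alpha> y i)"
  using mirror_\<alpha>[of x y 0 1] by simp

text \<open>The coordinate at \<open>z\<close> is fixed by the other two mirrors; the functionals with this property
  are its multiples.\<close>

lemma \<rho>_off_diagonal:
  assumes g: "g \<in> carrier H"
    and comm: "\<And>x y. x \<noteq> y \<Longrightarrow> g \<otimes>\<^bsub>H\<^esub> (r x \<otimes>\<^bsub>H\<^esub> r y) = r x \<otimes>\<^bsub>H\<^esub> r y \<otimes>\<^bsub>H\<^esub> g"
    and "z \<noteq> x"
  shows "\<rho> g (\<alpha> x) z = 0"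
proof -
  obtain y where y: "y \<noteq> x" "y \<noteq> z" using cgen_third[OF assms(3)] by blast
  \<comment> \<open>Insert \<open>mirror j\<close> twice and move \<open>g\<close> past
    \<open>r i \<otimes> r j\<close>. The mirrors then on the outside do not touch the coordinate at
    \<open>z\<close>.\<close>
  have inv: "\<rho> g (mirror i v) z = \<rho> g (mirror j v) z" if "i \<noteq> j" "i \<noteq> z" "j \<noteq> z" for i j v
  proof -
    have "\<rho> g (mirror i (mirror j (mirror j v))) = mirror i (mirror j (\<rho> g (mirror j v)))"
      using \<rho>_mult2[OF g] comm[OF that(1)] by metis
    moreover have "mirror i (mirror j (\<rho> g (mirror j v))) z = \<rho> g (mirror j v) z"
      using that by simp
    ultimately show ?thesis by simp
  qed
  have rel: "\<rho> g (\<alpha> i) z = - cs i j * \<rho> g (\<alpha> j) z" if "i \<noteq> j" "i \<noteq> z" "j \<noteq> z" for i j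
    using inv[OF that, of "\<alpha> i"] cs_sym[of i j]
    unfolding mirror_\<alpha>_same mirror_\<alpha>_other[OF that(1)[symmetric]] \<rho>_linear[OF g] by simp
  \<comment> \<open>Using \<open>rel\<close> from \<open>x\<close> to \<open>y\<close> and back
    reproduces the entry with a factor less than 1.\<close>
  have "\<rho> g (\<alpha> x) z = (cs x y)\<^sup>2 * \<rho> g (\<alpha> x) z"
    using rel[of x y] rel[of y x] y assms(3) cs_sym[of x y] by (simp add: power2_eq_square)
  then show ?thesis
    using cs_square_less[of x y] y by (metis less_irrefl mult_cancel_right1)
qed

text \<open>The quadratic form of the Tits form. It takes the value 1 at the simple roots, so its
  invariance forces eigenvalues there to be 1 or -1.\<close>

definition quad :: "(cgen \<Rightarrow> real) \<Rightarrow> real" where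
  "quad v = (v R1)\<^sup>2 + (v R2)\<^sup>2 + (v R3)\<^sup>2
     - 2 * (cs R1 R2 * v R1 * v R2 + cs R2 R3 * v R2 * v R3 + cs R3 R1 * v R3 * v R1)"

text \<open>The determinant with rows \<open>M i\<close>. Taking the images of the simple roots as
  rows gives the determinant of a group element, which records the parity of its words.\<close>

definition det3 :: "(cgen \<Rightarrow> cgen \<Rightarrow> real) \<Rightarrow> real" where
  "det3 M = M R1 R1 * (M R2 R2 * M R3 R3 - M R2 R3 * M R3 R2)
    - M R1 R2 * (M R2 R1 * M R3 R3 - M R2 R3 * M R3 R1)
    + M R1 R3 * (M R2 R1 * M R3 R2 - M R2 R2 * M R3 R1)"

lemma quad_mirror: "quad (mirror x v) = quad v"
  using cs_sym[of R2 R1] cs_sym[of R3 R2] cs_sym[of R1 R3]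
  by (cases x) (simp_all add: quad_def mirror_def cs_def[of x x] power2_eq_square algebra_simps,
    simp_all add: cs_def[of R1 R1] cs_def[of R2 R2] cs_def[of R3 R3] algebra_simps)

lemma det3_mirror: "det3 (\<lambda>i. mirror x (M i)) = - det3 M"
  by (cases x) (simp_all add: det3_def mirror_def algebra_simps cs_def[of R1 R1] cs_def[of R2 R2] cs_def[of R3 R3])

lemma quad_\<rho>: "g \<in> carrier H \<Longrightarrow> quad (\<rho> g v) = quad v"
proof -
  have "quad (wact mirror w v) = quad v" for w :: "cgen word"
    by (induction w) (simp_all add: quad_mirror)
  then show "g \<in> carrier H \<Longrightarrow> ?thesis" by (auto simp: carrier_H \<rho>_cls)
qed

lemma det3_\<rho>: "det3 (\<lambda>i. \<rho> (cls w) (M i)) = (-1) ^ length w * det3 M"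
  unfolding \<rho>_cls by (induction w) (simp_all add: det3_mirror)

text \<open>The simple roots are eigenvectors of \<open>g\<close>. The form, the determinant and the
  commutation leave the eigenvalues \<open>(1, 1, 1)\<close> or \<open>(-1, 1, -1)\<close>, the
  latter only for \<open>k = n = 2\<close>.\<close>

lemma even_central_trivial:
  assumes m: "m > 2" and odd: "n = 2 \<Longrightarrow> odd m"
    and g: "g \<in> carrier H" "even (L g)"
    and comm: "\<And>x y. x \<noteq> y \<Longrightarrow> g \<otimes>\<^bsub>H\<^esub> (r x \<otimes>\<^bsub>H\<^esub> r y) = r x \<otimes>\<^bsub>H\<^esub> r y \<otimes>\<^bsub>H\<^esub> g"
  shows "g = \<one>\<^bsub>H\<^esub>"
proof -
  define \<mu> where "\<mu> x = \<rho> g (\<alpha> x) x" for x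
  have diag: "\<rho> g (\<alpha> x) = (\<lambda>i. \<mu> x * \<alpha> x i)" for x
    using \<rho>_off_diagonal[OF g(1) comm] by (auto simp: \<mu>_def \<alpha>_def fun_eq_iff)
  have sq: "(\<mu> x)\<^sup>2 = 1" for x
    using quad_\<rho>[OF g(1), of "\<alpha> x"] unfolding diag by (cases x) (simp_all add: quad_def)
  obtain w where w: "g = cls w" "even (length w)"
    using g L_attained by metis
  have det: "\<mu> R1 * \<mu> R2 * \<mu> R3 = 1"
    using det3_\<rho>[of w \<alpha>] w(2) unfolding w(1)[symmetric] diag by (simp add: det3_def)
  \<comment> \<open>Evaluate the commutation with \<open>r x \<otimes> r y\<close> at
    \<open>\<alpha> y\<close> and compare coordinates at \<open>x\<close>. Both sides carry the
    factor \<open>cs x y\<close>, which is nonzero unless the order is 2.\<close>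
  have eq: "\<mu> x = \<mu> y" if "x \<noteq> y" "mm x y \<noteq> 2" for x y
  proof -
    have "\<rho> g (mirror x (mirror y (\<alpha> y))) x = mirror x (mirror y (\<rho> g (\<alpha> y))) x"
      using \<rho>_mult2[OF g(1), of x y "\<alpha> y"] comm[OF that(1)] by simp
    moreover have "mirror x (mirror y (\<lambda>i. p * \<alpha> y i)) = (\<lambda>i. (- 2 * cs x y * p) * \<alpha> x i + (- p) * \<alpha> y i)" for p
      using mirror_\<alpha>[of y x p 0] mirror_\<alpha>[of x y 0 "- p"] that(1) by simp
    from this[of 1] this[of "\<mu> y"] have "mirror x (mirror y (\<alpha> y)) = (\<lambda>i. (- 2 * cs x y) * \<alpha> x i + (- 1) * \<alpha> y i)"
      "mirror x (mirror y (\<rho> g (\<alpha> y))) x = - 2 * cs x y * \<mu> y" using that(1) unfolding diag by simp_all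
    ultimately have "- 2 * cs x y * \<mu> x = - 2 * cs x y * \<mu> y"
      using \<rho>_linear[OF g(1), of "- 2 * cs x y" "\<alpha> x" "-1" "\<alpha> y"] that(1) unfolding diag by simp
    then show ?thesis using that cs_zero_iff by simp
  qed
  \<comment> \<open>Here \<open>m > 2\<close> enters; the determinant then leaves only the value 1
    for \<open>\<mu> R2\<close>.\<close>
  have 13: "\<mu> R1 = \<mu> R3" using eq[of R1 R3] m by simp
  then have "\<mu> R2 * (\<mu> R3)\<^sup>2 = 1" using det by (simp add: power2_eq_square algebra_simps)
  then have 2: "\<mu> R2 = 1" using sq by simp
  show ?thesis
  proof (cases "\<mu> R1 = 1")
    case True
    then have "\<mu> x = 1" for x using 13 2 by (cases x) auto
    then show ?thesis by (intro \<rho>_faithful g(1)) (simp only: diag, simp add: \<alpha>_def)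
  next
    case False
    then have neg: "\<mu> R1 = -1" "\<mu> R3 = -1" using sq[of R1] 13 by (auto simp: power2_eq_1_iff)
    have kn: "k = 2" "n = 2" using eq[of R1 R2] eq[of R3 R2] neg 2 by auto
    then have "odd m" using odd by simp
    have sin_quot: "sin_quot x y (mm x y) = 0" "sin_quot x y (Suc (mm x y)) = -1" if "x \<noteq> y" for x y
    proof -
      define th where "th = pi / mm x y"
      have "real (mm x y) * th = pi" "sin th \<noteq> 0" using angle(3,4)[OF that] by (simp_all add: th_def)
      moreover from this have "real (Suc (mm x y)) * th = pi + th" by (simp add: algebra_simps)
      ultimately show "sin_quot x y (mm x y) = 0" "sin_quot x y (Suc (mm x y)) = -1"
        unfolding sin_quot_def th_def[symmetric] by simp_all
    qed
    \<comment> \<open>The longest element of the dihedral group of \<open>R1\<close> and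
      \<open>R3\<close>. For odd \<open>m\<close> it sends each of their two roots to the negative
      of the other. It fixes \<open>\<alpha> R2\<close>, which is orthogonal to both as
      \<open>k = n = 2\<close>. Hence \<open>g \<otimes> ?P\<close> permutes the simple roots and is
      trivial.\<close>
    let ?P = "alt_prod R1 R3 m"
    have P: "\<rho> ?P (\<alpha> x) = (\<lambda>i. (-1) * \<alpha> y i + 0 * \<alpha> y i)" if "x \<noteq> y" "mm x y = m" "alt_prod x y m = ?P" for x y
    proof -
      have "\<alpha> y = \<rho> ?P (\<lambda>i. (-1) * \<alpha> x i + 0 * \<alpha> x i)"
        using \<rho>_alternating[OF H.one_closed that(1), of m] sin_quot[OF that(1)] that \<open>odd m\<close>
        by (simp add: alt_letter_def)
      then have "\<alpha> y = (\<lambda>i. - \<rho> ?P (\<alpha> x) i)"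
        by (subst (asm) \<rho>_linear) auto
      then show ?thesis by (simp add: fun_eq_iff)
    qed
    have P1: "\<rho> ?P (\<alpha> R1) = (\<lambda>i. (-1) * \<alpha> R3 i + 0 * \<alpha> R3 i)" by (rule P) auto
    have P3: "\<rho> ?P (\<alpha> R3) = (\<lambda>i. (-1) * \<alpha> R1 i + 0 * \<alpha> R1 i)"
      by (rule P) (use alt_prod_braid[of R1 R3] in auto)
    have P2: "\<rho> ?P (\<alpha> R2) = \<alpha> R2"
    proof -
      have "\<rho> (alt_prod R1 R3 j) (\<alpha> R2) = \<alpha> R2" for j
      proof (induction j)
        case (Suc j)
        have "cs R1 R2 = 0" "cs R3 R2 = 0"
          using cs_zero_iff[of R1 R2] cs_zero_iff[of R3 R2] kn by (metis cgen.distinct mm.simps)+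
        then have "cs (alt_letter R1 R3 j) R2 = 0" by (simp add: alt_letter_def)
        moreover have "alt_letter R1 R3 j \<noteq> R2" by (simp add: alt_letter_def)
        ultimately have "mirror (alt_letter R1 R3 j) (\<alpha> R2) = \<alpha> R2" using mirror_\<alpha>_other[of "alt_letter R1 R3 j" R2] by simp
        then show ?case using Suc by (simp add: \<rho>_mult)
      qed simp
      then show ?thesis .
    qed
    have "\<rho> (g \<otimes>\<^bsub>H\<^esub> ?P) (\<alpha> x) i \<ge> 0" for x i
      by (cases x) (simp_all only: \<rho>_mult[OF g(1) alt_prod_closed] P1 P2 P3 \<rho>_linear[OF g(1)] diag neg 2,
        simp_all add: \<alpha>_def)
    then have "g \<otimes>\<^bsub>H\<^esub> ?P = \<one>\<^bsub>H\<^esub>" using g(1) by (intro \<rho>_faithful) auto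
    \<comment> \<open>A word of odd length \<open>m\<close> for \<open>?P\<close> and one of even
      length for \<open>g\<close> cannot multiply to the identity.\<close>
    moreover have "\<exists>v. alt_prod R1 R3 j = cls v \<and> length v = j" for j
    proof (induction j)
      case (Suc j)
      then obtain v where "alt_prod R1 R3 j = cls v" "length v = j" by blast
      then have "alt_prod R1 R3 (Suc j) = cls (v @ [(alt_letter R1 R3 j, True)]) \<and> length (v @ [(alt_letter R1 R3 j, True)]) = Suc j"
        by (simp add: cls_append)
      then show ?case by blast
    qed (simp add: cls_Nil)
    then obtain v where "?P = cls v" "length v = m" by blast
    ultimately have "cls (w @ v) = cls []" using w by (simp add: cls_append cls_Nil)
    from even_length_cls[OF this] have False using w(2) \<open>length v = m\<close> \<open>odd m\<close> by simp
    then show ?thesis ..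
  qed
qed

end


section \<open>The kernel of the map to the alternating subgroup\<close>

locale toric_triangle = toric_parameters k n m + triangle_group k n m for k n m +
  assumes n_less_m: "n < m"
begin

abbreviation Alt where "Alt \<equiv> cox_alt k n m"
abbreviation \<psi> where "\<psi> \<equiv> J_to_alt k n m"

section \<open>The alternating subgroup and the map from \<open>G\<close> onto it\<close>

lemma carrier_Alt: "carrier Alt = {g \<in> carrier H. even (L g)}"
  by (simp add: cox_alt_def)

lemma Alt_simps [simp]: "a \<otimes>\<^bsub>Alt\<^esub> b = a \<otimes>\<^bsub>H\<^esub> b" "\<one>\<^bsub>Alt\<^esub> = \<one>\<^bsub>H\<^esub>"
  by (simp_all add: cox_alt_def)

lemma Alt_subgroup: "subgroup (carrier Alt) H"
proof (rule H.subgroupI)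
  show "carrier Alt \<subseteq> carrier H" "carrier Alt \<noteq> {}"
    using even_L[of "[]"] by (auto simp: carrier_Alt intro!: exI[of _ "cls []"])
next
  fix g assume "g \<in> carrier Alt"
  then obtain w where w: "g = cls w" "even (length w)" by (auto simp: carrier_Alt carrier_H even_L)
  have "cls (winv w) \<otimes>\<^bsub>H\<^esub> cls w = \<one>\<^bsub>H\<^esub>"
    unfolding cls_append[symmetric] cls_Nil[symmetric] cls_eq_iff by (rule pres_rel_winv) simp
  then have "inv\<^bsub>H\<^esub> g = cls (winv w)" using w by (intro H.inv_equality) auto
  moreover have "length (winv w) = length w" by (simp add: winv_def)
  ultimately show "inv\<^bsub>H\<^esub> g \<in> carrier Alt" using w by (simp add: carrier_Alt even_L)
next
  fix g h assume "g \<in> carrier Alt" "h \<in> carrier Alt"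
  then obtain v w where "g = cls v" "even (length v)" "h = cls w" "even (length w)"
    by (auto simp: carrier_Alt carrier_H even_L)
  then show "g \<otimes>\<^bsub>H\<^esub> h \<in> carrier Alt" by (simp add: carrier_Alt even_L flip: cls_append)
qed

lemma Alt_eq: "Alt = H\<lparr>carrier := carrier Alt\<rparr>"
  by (simp add: cox_alt_def)

sublocale Alt: group Alt
  by (subst Alt_eq) (rule H.subgroup_imp_group[OF Alt_subgroup])

lemma Alt_inv: "g \<in> carrier Alt \<Longrightarrow> inv\<^bsub>Alt\<^esub> g = inv\<^bsub>H\<^esub> g"
  using H.m_inv_consistent[OF Alt_subgroup] Alt_eq by metis

lemma Alt_pow: "g [^]\<^bsub>Alt\<^esub> (j :: nat) = g [^]\<^bsub>H\<^esub> j"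
  by (induction j) simp_all

lemma cls2_Alt [simp]: "r a \<otimes>\<^bsub>H\<^esub> r b \<in> carrier Alt"
  by (simp add: carrier_Alt even_L flip: cls_append)

lemma J_to_alt_gen_eq:
  "J_to_alt_gen k n m Gs = r R1 \<otimes>\<^bsub>H\<^esub> r R2" "J_to_alt_gen k n m Gt = r R2 \<otimes>\<^bsub>H\<^esub> r R3"
  "J_to_alt_gen k n m Gu = r R3 \<otimes>\<^bsub>H\<^esub> r R1"
  by (simp_all flip: cls_append) (simp_all add: cls_def)

lemma J_to_alt_gen_closed: "J_to_alt_gen k n m x \<in> carrier Alt"
  by (cases x) (simp_all add: J_to_alt_gen_eq del: J_to_alt_gen.simps)

lemma J_to_alt_relations:
  assumes "(l, l') \<in> J_rels k n m"
  shows "eval_word Alt (J_to_alt_gen k n m) l = eval_word Alt (J_to_alt_gen k n m) l'"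
proof -
  have p: "eval_word Alt (J_to_alt_gen k n m) (wpow j (pos [x])) = J_to_alt_gen k n m x [^]\<^bsub>H\<^esub> j" for j x
    using Alt.eval_word_wpow[of UNIV "J_to_alt_gen k n m" "pos [x]" j] J_to_alt_gen_closed[of x]
      Alt.r_one[OF J_to_alt_gen_closed[of x]]
    by (simp add: J_to_alt_gen_closed words_def Alt_pow del: J_to_alt_gen.simps)
  have one: "r x \<otimes>\<^bsub>H\<^esub> (r y \<otimes>\<^bsub>H\<^esub> (r y \<otimes>\<^bsub>H\<^esub> (r w \<otimes>\<^bsub>H\<^esub> (r w \<otimes>\<^bsub>H\<^esub> r x)))) = \<one>\<^bsub>H\<^esub>" for x y w
    by (simp flip: H.m_assoc)
  show ?thesis
    using assms rr_pow[of R1 R2] rr_pow[of R2 R3] rr_pow[of R3 R1] one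
    by (auto simp: J_rels_def p J_to_alt_gen_eq H.m_assoc simp del: J_to_alt_gen.simps wpow_simps pos_simps)
      (simp_all add: J_to_alt_gen_eq H.m_assoc p[simplified] del: J_to_alt_gen.simps)
qed

lemma \<psi>_hom: "\<psi> \<in> hom G Alt"
  unfolding J_to_alt_def J_group_def
  by (rule pres_hom(1)[OF Alt.is_group _ J_to_alt_relations]) (rule J_to_alt_gen_closed)

lemma \<psi>_gen: "\<psi> (J_gen k n m x) = J_to_alt_gen k n m x"
proof -
  have "pos [x] \<in> words J_gens" by (cases x) (auto simp: J_gens_def)
  have "\<psi> (J_gen k n m x) = eval_word Alt (J_to_alt_gen k n m) (pos [x])"
    unfolding J_to_alt_def J_gen_def
    by (rule pres_hom(2)[OF Alt.is_group _ J_to_alt_relations]) (rule J_to_alt_gen_closed, assumption, fact)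
  then show ?thesis
    using Alt.r_one[OF J_to_alt_gen_closed[of x]] by simp
qed

sublocale \<psi>: group_hom G Alt \<psi>
  by unfold_locales (rule \<psi>_hom)

text \<open>An even word splits into pairs of letters, and each pair is the image of a generator,
  the inverse of one, or trivial.\<close>

lemma \<psi>_surj: "\<psi> ` carrier G = carrier Alt"
proof
  show "\<psi> ` carrier G \<subseteq> carrier Alt" using \<psi>.hom_closed by blast
  interpret I: subgroup "\<psi> ` carrier G" Alt by (rule \<psi>.img_is_subgroup)
  have gen: "J_to_alt_gen k n m x \<in> \<psi> ` carrier G" for x
    unfolding \<psi>_gen[symmetric] by (cases x) auto
  have rr: "r x \<otimes>\<^bsub>H\<^esub> r y \<in> \<psi> ` carrier G" for x y
  proof -
    have inv: "r y \<otimes>\<^bsub>H\<^esub> r x \<in> \<psi> ` carrier G" if "r x \<otimes>\<^bsub>H\<^esub> r y \<in> \<psi> ` carrier G" for x y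
      using I.m_inv_closed[OF that] by (simp add: Alt_inv H.inv_mult_group r_inv)
    show ?thesis
      using gen[of Gs] gen[of Gt] gen[of Gu] inv I.one_closed unfolding J_to_alt_gen_eq
      by (cases x; cases y) simp_all
  qed
  have "even (length w) \<Longrightarrow> cls w \<in> \<psi> ` carrier G" for w
  proof (induction "length w" arbitrary: w rule: less_induct)
    case less
    show ?case
    proof (cases "w = []")
      case True
      then show ?thesis using I.one_closed by (simp add: cls_Nil)
    next
      case False
      then obtain x b y c v where w: "w = [(x, b)] @ [(y, c)] @ v"
        using less.prems by (cases w; cases "tl w") auto
      then have "cls w = r x \<otimes>\<^bsub>H\<^esub> r y \<otimes>\<^bsub>H\<^esub> cls v"
        using cls_letter[of x b] cls_letter[of y c] unfolding w cls_append by (simp add: H.m_assoc)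
      moreover have "cls v \<in> \<psi> ` carrier G" using less w by simp
      ultimately show ?thesis using I.m_closed[OF rr] by simp
    qed
  qed
  then show "carrier Alt \<subseteq> \<psi> ` carrier G"
    by (auto simp: carrier_Alt carrier_H even_L)
qed

lemma \<psi>_z: "\<psi> z = \<one>\<^bsub>H\<^esub>"
proof -
  have "\<psi> z = J_to_alt_gen k n m Gs \<otimes>\<^bsub>H\<^esub> J_to_alt_gen k n m Gt \<otimes>\<^bsub>H\<^esub> J_to_alt_gen k n m Gu"
    unfolding z_eq \<psi>_gen[symmetric] by simp
  also have "\<dots> = r R1 \<otimes>\<^bsub>H\<^esub> r R2 \<otimes>\<^bsub>H\<^esub> r R2 \<otimes>\<^bsub>H\<^esub> r R3 \<otimes>\<^bsub>H\<^esub> r R3 \<otimes>\<^bsub>H\<^esub> r R1"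
    unfolding J_to_alt_gen_eq by (simp only: H.m_assoc H.m_closed cls_closed)
  also have "\<dots> = \<one>\<^bsub>H\<^esub>" by simp
  finally show ?thesis .
qed

text \<open>A lift to \<open>G\<close> of conjugation by \<open>R1\<close>.\<close>

fun \<sigma>_gen :: "jgen \<Rightarrow> jgen word set" where
  "\<sigma>_gen Gs = inv\<^bsub>G\<^esub> s"
| "\<sigma>_gen Gt = s \<otimes>\<^bsub>G\<^esub> inv\<^bsub>G\<^esub> t \<otimes>\<^bsub>G\<^esub> inv\<^bsub>G\<^esub> s"
| "\<sigma>_gen Gu = inv\<^bsub>G\<^esub> u"

lemma \<sigma>_gen_closed: "\<sigma>_gen x \<in> carrier G"
  by (cases x) simp_all

text \<open>The images are inverses of generators or conjugates of such, so the orders persist. All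
  three cyclic products are sent to the inverse of \<open>z\<close>.\<close>

lemma \<sigma>_relations:
  assumes "(l, l') \<in> J_rels k n m"
  shows "eval_word G \<sigma>_gen l = eval_word G \<sigma>_gen l'"
proof -
  have p: "eval_word G \<sigma>_gen (wpow j (pos [x])) = \<sigma>_gen x [^]\<^bsub>G\<^esub> j" for j x
    using G.eval_word_wpow[of UNIV \<sigma>_gen "pos [x]" j] G.r_one[OF \<sigma>_gen_closed[of x]]
    by (simp add: \<sigma>_gen_closed words_def del: \<sigma>_gen.simps)
  have pow: "\<sigma>_gen Gs [^]\<^bsub>G\<^esub> k = \<one>\<^bsub>G\<^esub>" "\<sigma>_gen Gt [^]\<^bsub>G\<^esub> n = \<one>\<^bsub>G\<^esub>" "\<sigma>_gen Gu [^]\<^bsub>G\<^esub> m = \<one>\<^bsub>G\<^esub>"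
    by (simp_all add: G.nat_pow_inv G.conj_pow J_pow_relations)
  let ?z = "\<lambda>a b c. eval_word G \<sigma>_gen (pos [a, b, c])"
  \<comment> \<open>After cancellation the three products are the inverse of \<open>u s t\<close>,
    the inverse of \<open>s t u\<close>, and a conjugate of the former by \<open>s\<close>.\<close>
  have z: "inv\<^bsub>G\<^esub> z = inv\<^bsub>G\<^esub> (u \<otimes>\<^bsub>G\<^esub> s \<otimes>\<^bsub>G\<^esub> t)" "inv\<^bsub>G\<^esub> z = inv\<^bsub>G\<^esub> (s \<otimes>\<^bsub>G\<^esub> t \<otimes>\<^bsub>G\<^esub> u)"
    by (simp_all only: z_eq z_cyclic)
  have 1: "?z Gs Gt Gu = inv\<^bsub>G\<^esub> z"
    unfolding z(1) by (simp add: G.inv_mult_group G.m_assoc G.mult_inv_cancel)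
  have 3: "?z Gu Gs Gt = inv\<^bsub>G\<^esub> z"
    unfolding z(2) by (simp add: G.inv_mult_group G.m_assoc G.mult_inv_cancel)
  have 2: "?z Gt Gu Gs = inv\<^bsub>G\<^esub> z"
  proof -
    have "?z Gt Gu Gs = s \<otimes>\<^bsub>G\<^esub> (inv\<^bsub>G\<^esub> z \<otimes>\<^bsub>G\<^esub> inv\<^bsub>G\<^esub> s)"
      unfolding z(1) by (simp add: G.inv_mult_group G.m_assoc)
    also have "inv\<^bsub>G\<^esub> z \<otimes>\<^bsub>G\<^esub> inv\<^bsub>G\<^esub> s = inv\<^bsub>G\<^esub> s \<otimes>\<^bsub>G\<^esub> inv\<^bsub>G\<^esub> z"
      using z_center by (simp add: center_def flip: G.inv_mult_group)
    finally show ?thesis by (simp add: G.mult_inv_cancel)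
  qed
  consider "l = wpow k (pos [Gs])" "l' = []" | "l = wpow n (pos [Gt])" "l' = []" | "l = wpow m (pos [Gu])" "l' = []"
    | "l = pos [Gs, Gt, Gu]" "l' = pos [Gt, Gu, Gs]" | "l = pos [Gt, Gu, Gs]" "l' = pos [Gu, Gs, Gt]"
    using assms unfolding J_rels_def by blast
  then show ?thesis
    by cases (simp_all only: p pow 1 2 3 eval_word.simps)
qed

definition \<sigma> :: "jgen word set \<Rightarrow> jgen word set" where
  "\<sigma> = pres_hom G \<sigma>_gen"

lemma \<sigma>_hom: "\<sigma> \<in> hom G G"
  unfolding \<sigma>_def by (subst (1) J_group_def) (rule pres_hom(1)[OF G.is_group _ \<sigma>_relations], rule \<sigma>_gen_closed)

lemma \<sigma>_J_gen: "\<sigma> (J_gen k n m x) = \<sigma>_gen x"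
proof -
  have "pos [x] \<in> words J_gens" by (cases x) (auto simp: J_gens_def)
  have "\<sigma> (J_gen k n m x) = eval_word G \<sigma>_gen (pos [x])"
    unfolding \<sigma>_def J_gen_def
    by (rule pres_hom(2)[OF G.is_group _ \<sigma>_relations]) (rule \<sigma>_gen_closed, assumption, fact)
  then show ?thesis
    using G.r_one[OF \<sigma>_gen_closed[of x]] by simp
qed

sublocale \<sigma>: group_hom G G \<sigma>
  by unfold_locales (rule \<sigma>_hom)

lemma \<sigma>_\<sigma>: "g \<in> carrier G \<Longrightarrow> \<sigma> (\<sigma> g) = g"
  using G_hom_eq[of "\<sigma> \<circ> \<sigma>" G "\<lambda>g. g" g] hom_compose[OF \<sigma>_hom \<sigma>_hom] G.is_group
  by (simp add: hom_def \<sigma>_J_gen G.inv_mult_group G.m_assoc G.mult_inv_cancel)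

lemma \<sigma>_z: "\<sigma> z = inv\<^bsub>G\<^esub> z"
proof -
  have "inv\<^bsub>G\<^esub> z = inv\<^bsub>G\<^esub> (u \<otimes>\<^bsub>G\<^esub> s \<otimes>\<^bsub>G\<^esub> t)" by (simp only: z_eq z_cyclic)
  then show ?thesis
    by (simp add: z_eq[of] \<sigma>_J_gen G.inv_mult_group G.m_assoc G.mult_inv_cancel)
qed

section \<open>The action of the Coxeter group on \<open>G\<close> modulo the powers of
  \<open>z\<close>\<close>

definition z_cong :: "(jgen word set \<times> jgen word set) set" where
  "z_cong = {(g, h). g \<in> carrier G \<and> h \<in> carrier G \<and> (\<exists>i::int. h = z [^]\<^bsub>G\<^esub> i \<otimes>\<^bsub>G\<^esub> g)}"

lemma z_pow_commute: "g \<in> carrier G \<Longrightarrow> z [^]\<^bsub>G\<^esub> (i::int) \<otimes>\<^bsub>G\<^esub> g = g \<otimes>\<^bsub>G\<^esub> z [^]\<^bsub>G\<^esub> i"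
  using G.center_int_pow[OF z_center, of i] by (simp add: center_def)

lemma z_cong_equiv: "equiv (carrier G) z_cong"
proof (rule equivI)
  show "z_cong \<subseteq> carrier G \<times> carrier G" by (auto simp: z_cong_def)
  show "refl_on (carrier G) z_cong"
    by (auto simp: refl_on_def z_cong_def intro!: exI[of _ "0::int"])
  show "sym z_cong"
  proof (rule symI)
    fix g h assume "(g, h) \<in> z_cong"
    then obtain i where "g \<in> carrier G" "h \<in> carrier G" "h = z [^]\<^bsub>G\<^esub> (i::int) \<otimes>\<^bsub>G\<^esub> g" by (auto simp: z_cong_def)
    then have "g = z [^]\<^bsub>G\<^esub> (- i) \<otimes>\<^bsub>G\<^esub> h" by (simp add: G.int_pow_neg G.mult_inv_cancel)
    then show "(h, g) \<in> z_cong" using \<open>g \<in> carrier G\<close> \<open>h \<in> carrier G\<close> unfolding z_cong_def by blast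
  qed
  show "trans z_cong"
  proof (rule transI)
    fix g h l assume "(g, h) \<in> z_cong" "(h, l) \<in> z_cong"
    then obtain i j where "g \<in> carrier G" "h = z [^]\<^bsub>G\<^esub> (i::int) \<otimes>\<^bsub>G\<^esub> g" "l \<in> carrier G" "l = z [^]\<^bsub>G\<^esub> (j::int) \<otimes>\<^bsub>G\<^esub> h"
      by (auto simp: z_cong_def)
    then have "g \<in> carrier G" "l \<in> carrier G" "l = z [^]\<^bsub>G\<^esub> (j + i) \<otimes>\<^bsub>G\<^esub> g" by (simp_all add: G.int_pow_mult G.m_assoc)
    then show "(g, l) \<in> z_cong" unfolding z_cong_def by blast
  qed
qed

text \<open>\<open>R1\<close> acts as \<open>\<sigma>\<close>; the other two are dictated by \<open>R2 = s\<inverse> R1\<close> and \<open>R3 = u R1\<close>.\<close>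

fun act :: "cgen \<Rightarrow> jgen word set \<Rightarrow> jgen word set" where
  "act R1 g = \<sigma> g"
| "act R2 g = inv\<^bsub>G\<^esub> s \<otimes>\<^bsub>G\<^esub> \<sigma> g"
| "act R3 g = u \<otimes>\<^bsub>G\<^esub> \<sigma> g"

lemma z_cong_mult: "a \<in> carrier G \<Longrightarrow> (g, h) \<in> z_cong \<Longrightarrow> (a \<otimes>\<^bsub>G\<^esub> g, a \<otimes>\<^bsub>G\<^esub> h) \<in> z_cong"
proof -
  assume a: "a \<in> carrier G" and "(g, h) \<in> z_cong"
  then obtain i where g: "g \<in> carrier G" "h = z [^]\<^bsub>G\<^esub> (i::int) \<otimes>\<^bsub>G\<^esub> g" by (auto simp: z_cong_def)
  then have "a \<otimes>\<^bsub>G\<^esub> h = z [^]\<^bsub>G\<^esub> i \<otimes>\<^bsub>G\<^esub> (a \<otimes>\<^bsub>G\<^esub> g)"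
    using a z_pow_commute[OF a, of i] by (simp flip: G.m_assoc)
  then show ?thesis using a g unfolding z_cong_def by auto
qed

lemma E_\<sigma>: "(g, h) \<in> z_cong \<Longrightarrow> (\<sigma> g, \<sigma> h) \<in> z_cong"
proof -
  assume "(g, h) \<in> z_cong"
  then obtain i where g: "g \<in> carrier G" "h = z [^]\<^bsub>G\<^esub> (i::int) \<otimes>\<^bsub>G\<^esub> g" by (auto simp: z_cong_def)
  then have "\<sigma> h = z [^]\<^bsub>G\<^esub> (- i) \<otimes>\<^bsub>G\<^esub> \<sigma> g"
    by (simp add: \<sigma>.hom_int_pow \<sigma>_z G.int_pow_inv G.int_pow_neg)
  then show ?thesis using g unfolding z_cong_def by auto
qed

lemma act_z_cong: "(g, h) \<in> z_cong \<Longrightarrow> (act x g, act x h) \<in> z_cong"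
  by (cases x) (simp_all add: z_cong_mult E_\<sigma>)

lemma act_act: "g \<in> carrier G \<Longrightarrow> act x (act x g) = g"
  by (cases x) (simp_all add: \<sigma>_\<sigma> \<sigma>_J_gen G.mult_inv_cancel)

text \<open>The middle product acts as multiplication by \<open>inv s \<otimes> inv u\<close>, which
  is \<open>t\<close> divided by \<open>z\<close> since \<open>z = t u s\<close>. This factor is why
  the action is considered only modulo \<open>z\<close>.\<close>

lemma act2:
  assumes "g \<in> carrier G"
  shows "act R1 (act R2 g) = s \<otimes>\<^bsub>G\<^esub> g"
    and "act R2 (act R3 g) = z [^]\<^bsub>G\<^esub> (-1::int) \<otimes>\<^bsub>G\<^esub> (t \<otimes>\<^bsub>G\<^esub> g)"
    and "act R3 (act R1 g) = u \<otimes>\<^bsub>G\<^esub> g"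
proof -
  show "act R1 (act R2 g) = s \<otimes>\<^bsub>G\<^esub> g" "act R3 (act R1 g) = u \<otimes>\<^bsub>G\<^esub> g"
    using assms by (simp_all add: \<sigma>_\<sigma> \<sigma>_J_gen)
  have "inv\<^bsub>G\<^esub> z = inv\<^bsub>G\<^esub> (t \<otimes>\<^bsub>G\<^esub> u \<otimes>\<^bsub>G\<^esub> s)" by (simp only: z_eq z_cyclic)
  then have "z [^]\<^bsub>G\<^esub> (-1::int) \<otimes>\<^bsub>G\<^esub> t = inv\<^bsub>G\<^esub> s \<otimes>\<^bsub>G\<^esub> inv\<^bsub>G\<^esub> u"
    by (simp add: G.int_pow_neg G.inv_mult_group G.m_assoc)
  then show "act R2 (act R3 g) = z [^]\<^bsub>G\<^esub> (-1::int) \<otimes>\<^bsub>G\<^esub> (t \<otimes>\<^bsub>G\<^esub> g)"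
    using assms by (simp add: \<sigma>_\<sigma> \<sigma>_J_gen flip: G.m_assoc)
qed

lemma act2_z_cong:
  assumes "g \<in> carrier G"
  shows "(act R1 (act R2 g), s \<otimes>\<^bsub>G\<^esub> g) \<in> z_cong" "(act R2 (act R3 g), t \<otimes>\<^bsub>G\<^esub> g) \<in> z_cong"
    "(act R3 (act R1 g), u \<otimes>\<^bsub>G\<^esub> g) \<in> z_cong"
proof -
  have refl: "(a, a) \<in> z_cong" if "a \<in> carrier G" for a
    using z_cong_equiv that by (auto simp: equiv_def refl_on_def)
  show "(act R1 (act R2 g), s \<otimes>\<^bsub>G\<^esub> g) \<in> z_cong" "(act R3 (act R1 g), u \<otimes>\<^bsub>G\<^esub> g) \<in> z_cong"
    unfolding act2[OF assms] using assms by (simp_all add: refl)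
  have "(t \<otimes>\<^bsub>G\<^esub> g, z [^]\<^bsub>G\<^esub> (-1::int) \<otimes>\<^bsub>G\<^esub> (t \<otimes>\<^bsub>G\<^esub> g)) \<in> z_cong"
    using assms by (simp add: z_cong_def) blast
  then show "(act R2 (act R3 g), t \<otimes>\<^bsub>G\<^esub> g) \<in> z_cong"
    unfolding act2[OF assms] using z_cong_equiv by (auto simp: equiv_def dest: symD)
qed

lemma act_wpow_z_cong:
  fixes p q :: cgen
  assumes "\<And>g. g \<in> carrier G \<Longrightarrow> (act p (act q g), a \<otimes>\<^bsub>G\<^esub> g) \<in> z_cong" "a \<in> carrier G" "g \<in> carrier G"
  shows "(wact act (wpow j (pos [p, q])) g, a [^]\<^bsub>G\<^esub> j \<otimes>\<^bsub>G\<^esub> g) \<in> z_cong"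
proof (induction j)
  case 0
  then show ?case using assms(3) z_cong_equiv by (auto simp: equiv_def refl_on_def)
next
  case (Suc j)
  then have "(act p (act q (wact act (wpow j (pos [p, q])) g)), act p (act q (a [^]\<^bsub>G\<^esub> j \<otimes>\<^bsub>G\<^esub> g))) \<in> z_cong"
    by (intro act_z_cong)
  moreover have "(act p (act q (a [^]\<^bsub>G\<^esub> j \<otimes>\<^bsub>G\<^esub> g)), a \<otimes>\<^bsub>G\<^esub> (a [^]\<^bsub>G\<^esub> j \<otimes>\<^bsub>G\<^esub> g)) \<in> z_cong"
    using assms by simp
  moreover have "a \<otimes>\<^bsub>G\<^esub> (a [^]\<^bsub>G\<^esub> j \<otimes>\<^bsub>G\<^esub> g) = a [^]\<^bsub>G\<^esub> Suc j \<otimes>\<^bsub>G\<^esub> g"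
    unfolding G.nat_pow_Suc2[OF assms(2)] using assms(2,3) by (simp add: G.m_assoc)
  ultimately show ?case using z_cong_equiv by (auto simp: equiv_def dest: transD)
qed

text \<open>The relators of length 2 act trivially because \<open>act x\<close> is an involution.
  The other three act, modulo \<open>z\<close>, as multiplication by powers of \<open>s\<close>,
  \<open>t\<close> and \<open>u\<close> that are trivial in \<open>G\<close>.\<close>

lemma wact_act:
  assumes "cls v = cls w" "g \<in> carrier G"
  shows "(wact act v g, wact act w g) \<in> z_cong"
proof (rule wact_pres_rel[OF z_cong_equiv])
  show "(v, w) \<in> pres_rel cox_gens (cox_rels k n m)" using assms(1) by (simp add: cls_eq_iff)
next
  fix l l' g assume ll: "(l, l') \<in> cox_rels k n m" and g: "g \<in> carrier G"
  have refl: "(g, g) \<in> z_cong" using z_cong_equiv g by (auto simp: equiv_def refl_on_def)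
  have 2: "(wact act (wpow 2 (pos [x])) g, g) \<in> z_cong" for x
    using g refl by (simp add: numeral_2_eq_2 act_act)
  have "(wact act (wpow k (pos [R1, R2])) g, g) \<in> z_cong" "(wact act (wpow n (pos [R2, R3])) g, g) \<in> z_cong"
    "(wact act (wpow m (pos [R3, R1])) g, g) \<in> z_cong"
    using act_wpow_z_cong[OF act2_z_cong(1) stu_closed(1) g, of k] act_wpow_z_cong[OF act2_z_cong(2) stu_closed(2) g, of n]
      act_wpow_z_cong[OF act2_z_cong(3) stu_closed(3) g, of m] g unfolding J_pow_relations by simp_all
  with ll 2 show "(wact act l g, wact act l' g) \<in> z_cong"
    unfolding cox_rels_def by auto
next
  fix x and g assume g: "g \<in> carrier G"
  then have "(g, g) \<in> z_cong" using z_cong_equiv by (auto simp: equiv_def refl_on_def)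
  then show "(act x (act x g), g) \<in> z_cong" using g by (simp add: act_act)
qed (use act_z_cong assms in auto)

text \<open>The elements with such a word form a subgroup, and it contains the generators by
  \<open>act2_z_cong\<close>.\<close>

lemma \<psi>_lift:
  assumes "g \<in> carrier G"
  shows "\<exists>w. \<psi> g = cls w \<and> (\<forall>h\<in>carrier G. (wact act w h, g \<otimes>\<^bsub>G\<^esub> h) \<in> z_cong)"
proof -
  define K where "K = {g \<in> carrier G. \<exists>w. \<psi> g = cls w \<and> (\<forall>h\<in>carrier G. (wact act w h, g \<otimes>\<^bsub>G\<^esub> h) \<in> z_cong)}"
  have tr: "(a, c) \<in> z_cong" if "(a, b) \<in> z_cong" "(b, c) \<in> z_cong" for a b c
    using z_cong_equiv that by (auto simp: equiv_def dest: transD)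
  have sy: "(b, a) \<in> z_cong" if "(a, b) \<in> z_cong" for a b
    using z_cong_equiv that by (auto simp: equiv_def dest: symD)
  have cong: "(wact act w a, wact act w b) \<in> z_cong" if "(a, b) \<in> z_cong" for w a b
    by (rule wact_cong[of cox_gens, OF act_z_cong]) (use that in auto)
  have "subgroup K G"
  proof (rule G.subgroupI)
    have "\<one>\<^bsub>G\<^esub> \<in> K"
      unfolding K_def using z_cong_equiv by (auto simp: equiv_def refl_on_def cls_Nil intro!: exI[of _ "[]"])
    then show "K \<noteq> {}" by blast
  next
    fix g assume "g \<in> K"
    then obtain w where g: "g \<in> carrier G" "\<psi> g = cls w" and w: "\<And>h. h \<in> carrier G \<Longrightarrow> (wact act w h, g \<otimes>\<^bsub>G\<^esub> h) \<in> z_cong"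
      unfolding K_def by blast
    have eq: "cls (winv w @ w) = cls []"
      unfolding cls_eq_iff by (rule pres_rel_winv) simp
    then have "inv\<^bsub>H\<^esub> (cls w) = cls (winv w)" by (intro H.inv_equality) (simp_all add: cls_append cls_Nil)
    then have "\<psi> (inv\<^bsub>G\<^esub> g) = cls (winv w)" using g Alt_inv \<psi>.hom_closed[OF g(1)] by simp
    moreover have "(wact act (winv w) h, inv\<^bsub>G\<^esub> g \<otimes>\<^bsub>G\<^esub> h) \<in> z_cong" if h: "h \<in> carrier G" for h
    proof -
      \<comment> \<open>Let \<open>winv w\<close> act on both sides. On the right,
        \<open>winv w @ w\<close> represents the identity and acts trivially modulo
        \<open>z\<close>.\<close>
      have "(h, wact act w (inv\<^bsub>G\<^esub> g \<otimes>\<^bsub>G\<^esub> h)) \<in> z_cong"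
        using sy[OF w[of "inv\<^bsub>G\<^esub> g \<otimes>\<^bsub>G\<^esub> h"]] g h by (simp add: G.mult_inv_cancel)
      then have "(wact act (winv w) h, wact act (winv w @ w) (inv\<^bsub>G\<^esub> g \<otimes>\<^bsub>G\<^esub> h)) \<in> z_cong"
        unfolding wact_append by (rule cong)
      moreover have "(wact act (winv w @ w) (inv\<^bsub>G\<^esub> g \<otimes>\<^bsub>G\<^esub> h), wact act [] (inv\<^bsub>G\<^esub> g \<otimes>\<^bsub>G\<^esub> h)) \<in> z_cong"
        by (rule wact_act[OF eq]) (use g h in simp)
      ultimately show ?thesis using tr by simp
    qed
    ultimately show "inv\<^bsub>G\<^esub> g \<in> K" using g unfolding K_def by blast
  next
    fix a b assume "a \<in> K" "b \<in> K"
    then obtain v w where a: "a \<in> carrier G" "\<psi> a = cls v" and v: "\<And>h. h \<in> carrier G \<Longrightarrow> (wact act v h, a \<otimes>\<^bsub>G\<^esub> h) \<in> z_cong"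
      and b: "b \<in> carrier G" "\<psi> b = cls w" and w: "\<And>h. h \<in> carrier G \<Longrightarrow> (wact act w h, b \<otimes>\<^bsub>G\<^esub> h) \<in> z_cong"
      unfolding K_def by blast
    have "(wact act (v @ w) h, a \<otimes>\<^bsub>G\<^esub> b \<otimes>\<^bsub>G\<^esub> h) \<in> z_cong" if "h \<in> carrier G" for h
      using tr[OF cong[OF w[OF that]] v[of "b \<otimes>\<^bsub>G\<^esub> h"]] a b that by (simp add: G.m_assoc)
    moreover have "\<psi> (a \<otimes>\<^bsub>G\<^esub> b) = cls (v @ w)" using a b by (simp add: cls_append)
    ultimately show "a \<otimes>\<^bsub>G\<^esub> b \<in> K" using a b unfolding K_def by blast
  qed (auto simp: K_def)
  moreover have "J_gen k n m x \<in> K" for x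
  proof -
    have "\<exists>a b. \<psi> (J_gen k n m x) = cls [(a, True), (b, True)] \<and>
      (\<forall>h\<in>carrier G. (act a (act b h), J_gen k n m x \<otimes>\<^bsub>G\<^esub> h) \<in> z_cong)"
    proof (cases x)
      case Gs
      then show ?thesis using act2_z_cong(1) by (intro exI[of _ R1] exI[of _ R2]) (simp add: \<psi>_gen cls_def)
    next
      case Gt
      then show ?thesis using act2_z_cong(2) by (intro exI[of _ R2] exI[of _ R3]) (simp add: \<psi>_gen cls_def)
    next
      case Gu
      then show ?thesis using act2_z_cong(3) by (intro exI[of _ R3] exI[of _ R1]) (simp add: \<psi>_gen cls_def)
    qed
    then obtain a b where "\<psi> (J_gen k n m x) = cls [(a, True), (b, True)]"
      "\<forall>h\<in>carrier G. (wact act [(a, True), (b, True)] h, J_gen k n m x \<otimes>\<^bsub>G\<^esub> h) \<in> z_cong" by auto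
    moreover have "J_gen k n m x \<in> carrier G" by (cases x) auto
    ultimately show ?thesis unfolding K_def by blast
  qed
  ultimately have "K = carrier G"
    unfolding J_group_def J_gen_def by (intro presented_group_subgroup_eq) auto
  then show ?thesis using assms unfolding K_def by blast
qed

text \<open>A word for the image of \<open>g\<close> sends the identity of \<open>G\<close> to
  \<open>g\<close> modulo \<open>z\<close>; if that image is trivial, the word also fixes the
  identity modulo \<open>z\<close>.\<close>

lemma \<psi>_kernel:
  assumes "g \<in> carrier G" "\<psi> g = \<one>\<^bsub>H\<^esub>"
  shows "\<exists>i::int. g = z [^]\<^bsub>G\<^esub> i"
proof -
  obtain w where w: "cls w = cls []" "(wact act w \<one>\<^bsub>G\<^esub>, g \<otimes>\<^bsub>G\<^esub> \<one>\<^bsub>G\<^esub>) \<in> z_cong"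
    using \<psi>_lift[OF assms(1)] assms(2) by (auto simp: cls_Nil)
  have "(wact act w \<one>\<^bsub>G\<^esub>, wact act [] \<one>\<^bsub>G\<^esub>) \<in> z_cong" by (rule wact_act[OF w(1)]) simp
  with w(2) have "(\<one>\<^bsub>G\<^esub>, g \<otimes>\<^bsub>G\<^esub> \<one>\<^bsub>G\<^esub>) \<in> z_cong"
    using z_cong_equiv unfolding equiv_def by (metis symD transD wact.simps(1))
  then show ?thesis using assms by (auto simp: z_cong_def)
qed

end


section \<open>The theorem\<close>

text \<open>A surjection carries central elements to central elements, here to the identity.\<close>

lemma group_hom_center_eq_kernel:
  assumes "group_hom A B h" "h ` carrier A = carrier B" "center B \<subseteq> {\<one>\<^bsub>B\<^esub>}" "kernel A B h \<subseteq> center A"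
  shows "center A = kernel A B h"
proof (rule subset_antisym[OF subsetI assms(4)])
  interpret h: group_hom A B h by fact
  fix a assume "a \<in> center A"
  then have a: "a \<in> carrier A" and comm: "\<And>x. x \<in> carrier A \<Longrightarrow> a \<otimes>\<^bsub>A\<^esub> x = x \<otimes>\<^bsub>A\<^esub> a"
    unfolding center_def by blast+
  have "h a \<otimes>\<^bsub>B\<^esub> b = b \<otimes>\<^bsub>B\<^esub> h a" if b: "b \<in> carrier B" for b
  proof -
    obtain x where x: "x \<in> carrier A" "b = h x" using b unfolding assms(2)[symmetric] by blast
    have "h (a \<otimes>\<^bsub>A\<^esub> x) = h (x \<otimes>\<^bsub>A\<^esub> a)" by (rule arg_cong[OF comm[OF x(1)]])
    then show ?thesis using h.hom_mult[OF a x(1)] h.hom_mult[OF x(1) a] x(2) by metis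
  qed
  then have "h a \<in> center B" using h.hom_closed[OF a] unfolding center_def by blast
  then show "a \<in> kernel A B h" using assms(3) a unfolding kernel_def by blast
qed

lemma (in group) carrier_subgroup_generated_singleton:
  assumes "a \<in> carrier G"
  shows "carrier (subgroup_generated G {a}) = generate G {a}"
  using assms by (simp add: carrier_subgroup_generated)

lemma (in group) normal_closure_center:
  assumes "a \<in> center G"
  shows "normal_closure G {a} = generate G {a}"
proof -
  have a: "a \<in> carrier G" using assms by (simp add: center_def)
  have conj: "g \<otimes> a \<otimes> inv g = a" if "g \<in> carrier G" for g
  proof -
    have "g \<otimes> a = a \<otimes> g" using assms that unfolding center_def by force
    then show ?thesis using that a inv_solve_right' by simp
  qed
  have "{g \<otimes> b \<otimes> inv g | g b. g \<in> carrier G \<and> b \<in> {a}} = (\<lambda>g. g \<otimes> a \<otimes> inv g) ` carrier G"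
    by auto
  also have "\<dots> = (\<lambda>_. a) ` carrier G"
    by (rule image_cong[OF HOL.refl conj])
  also have "\<dots> = {a}"
    using one_closed by (rule image_constant)
  finally have "{g \<otimes> b \<otimes> inv g | g b. g \<in> carrier G \<and> b \<in> {a}} = {a}" .
  then show ?thesis unfolding normal_closure_def by (rule arg_cong)
qed

lemma short_exactI:
  assumes "group_hom A B h" "h ` carrier A = carrier B" "a \<in> carrier A" "kernel A B h = generate A {a}"
  shows "short_exact (subgroup_generated A {a}) id A h B"
proof -
  interpret h: group_hom A B h by fact
  have sub: "generate A {a} \<subseteq> carrier A" using assms(3) by (intro h.G.generate_incl) simp
  have carrier: "carrier (subgroup_generated A {a}) = generate A {a}"
    by (rule h.G.carrier_subgroup_generated_singleton[OF assms(3)])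
  have "id \<in> mon (subgroup_generated A {a}) A"
    unfolding mon_def hom_def using sub by (auto simp: carrier)
  moreover have "h \<in> epi A B"
    unfolding epi_def using h.homh assms(2) by simp
  ultimately show ?thesis
    using h.G.group_subgroup_generated h.G.is_group h.H.is_group
    unfolding short_exact_def carrier assms(4) image_id by simp
qed

context toric_triangle
begin

section \<open>Kernels and centers\<close>

abbreviation \<chi> where "\<chi> \<equiv> toric_to_alt k n m"

lemma center_Alt: "center Alt \<subseteq> {\<one>\<^bsub>Alt\<^esub>}"
proof
  fix g assume g: "g \<in> center Alt"
  have "g = \<one>\<^bsub>H\<^esub>"
  proof (rule even_central_trivial)
    show "m > 2" using n2 n_less_m by simp
    \<comment> \<open>Coprimality rules out the dihedral groups whose longest element is even and
      central.\<close>
    show "odd m" if "n = 2" using coprime that by simp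
    show "g \<in> carrier H" "even (L g)" using g by (simp_all add: center_def carrier_Alt)
    show "g \<otimes>\<^bsub>H\<^esub> (r a \<otimes>\<^bsub>H\<^esub> r b) = r a \<otimes>\<^bsub>H\<^esub> r b \<otimes>\<^bsub>H\<^esub> g" for a b
      using g cls2_Alt[of a b] by (simp add: center_def)
  qed
  then show "g \<in> {\<one>\<^bsub>Alt\<^esub>}" by simp
qed

lemma \<chi>_eq: "\<chi> w = \<psi> (incl w)"
  by (simp add: toric_to_alt_def)

lemma \<chi>_hom: "\<chi> \<in> hom W Alt"
  unfolding toric_to_alt_def by (rule hom_compose[OF incl_hom \<psi>_hom])

sublocale \<chi>: group_hom W Alt \<chi>
  by unfold_locales (rule \<chi>_hom)

lemma \<psi>_z_pow: "\<psi> (z [^]\<^bsub>G\<^esub> (i::int)) = \<one>\<^bsub>H\<^esub>"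
proof -
  have "\<psi> z = \<one>\<^bsub>Alt\<^esub>" by (simp add: \<psi>_z)
  then have "\<psi> (z [^]\<^bsub>G\<^esub> i) = \<one>\<^bsub>Alt\<^esub>"
    by (simp only: \<psi>.hom_int_pow[OF z_closed] Alt.int_pow_one)
  then show ?thesis by simp
qed

text \<open>In the decomposition of an element of \<open>G\<close>, the power of \<open>z\<close>
  dies under \<open>\<psi>\<close>, so the factor from \<open>W\<close> already has the required
  image.\<close>

lemma \<chi>_surj: "\<chi> ` carrier W = carrier Alt"
proof
  show "\<chi> ` carrier W \<subseteq> carrier Alt" using \<chi>.hom_closed by blast
  show "carrier Alt \<subseteq> \<chi> ` carrier W"
  proof
    fix a assume "a \<in> carrier Alt"
    then obtain g where g: "g \<in> carrier G" "a = \<psi> g" unfolding \<psi>_surj[symmetric] by blast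
    obtain w i where w: "w \<in> carrier W" "g = incl w \<otimes>\<^bsub>G\<^esub> z [^]\<^bsub>G\<^esub> (i::int)"
      by (rule G_decomposition[OF g(1)])
    have "\<psi> g = \<psi> (incl w) \<otimes>\<^bsub>Alt\<^esub> \<one>\<^bsub>Alt\<^esub>"
      using w by (simp add: \<psi>_z_pow)
    also have "\<dots> = \<chi> w"
      by (simp only: Alt.r_one \<psi>.hom_closed incl.hom_closed w(1) \<chi>_eq)
    finally show "a \<in> \<chi> ` carrier W" using g w by blast
  qed
qed

lemma kernel_\<psi>: "kernel G Alt \<psi> = generate G {z}"
  using \<psi>_kernel \<psi>_z_pow by (auto simp: kernel_def G.generate_pow)

text \<open>The kernel of \<open>\<psi>\<close> consists of the powers of \<open>z\<close>, and
  those lying in \<open>W\<close> are the powers of \<open>c\<close>.\<close>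

lemma kernel_\<chi>: "kernel W Alt \<chi> = generate W {c}"
proof -
  have "\<exists>i::int. w = c [^]\<^bsub>W\<^esub> i" if w: "w \<in> carrier W" "\<chi> w = \<one>\<^bsub>H\<^esub>" for w
  proof -
    obtain i :: int where "incl w = z [^]\<^bsub>G\<^esub> i"
      using \<psi>_kernel[of "incl w"] w by (auto simp: \<chi>_eq)
    then show ?thesis using incl_eq_z_pow[OF w(1)] by blast
  qed
  moreover have "\<chi> (c [^]\<^bsub>W\<^esub> (i::int)) = \<one>\<^bsub>H\<^esub>" for i
  proof -
    have "\<chi> c = \<one>\<^bsub>Alt\<^esub>"
      using \<psi>_z_pow[of "int (n * m)"] unfolding int_pow_int by (simp add: \<chi>_eq incl_c)
    then have "\<chi> (c [^]\<^bsub>W\<^esub> i) = \<one>\<^bsub>Alt\<^esub>"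
      by (simp only: \<chi>.hom_int_pow[OF c_closed] Alt.int_pow_one)
    then show ?thesis by simp
  qed
  ultimately show ?thesis by (auto simp: kernel_def W.generate_pow)
qed

lemma center_G: "center G = generate G {z}"
proof -
  have "generate G {z} \<subseteq> center G"
    using G.generate_subgroup_incl[OF _ G.center_subgroup] z_center by simp
  then show ?thesis
    using group_hom_center_eq_kernel[OF \<psi>.group_hom_axioms \<psi>_surj center_Alt] kernel_\<psi> by simp
qed

lemma center_W: "center W = generate W {c}"
proof -
  have "generate W {c} \<subseteq> center W"
    using W.generate_subgroup_incl[OF _ W.center_subgroup] c_center by simp
  then show ?thesis
    using group_hom_center_eq_kernel[OF \<chi>.group_hom_axioms \<chi>_surj center_Alt] kernel_\<chi> by simp
qed

section \<open>Quotients by the centers\<close>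

lemma toric_quot_eq: "toric_quot k n m = W Mod center W"
  by (simp add: toric_quot_def W.normal_closure_center[OF c_center] center_W)

lemma iso_Alt:
  "induced_map \<psi> \<in> iso (G Mod center G) Alt" "induced_map \<chi> \<in> iso (W Mod center W) Alt"
  using \<psi>.FactGroup_iso_set[OF \<psi>_surj] \<chi>.FactGroup_iso_set[OF \<chi>_surj]
  unfolding induced_map_def center_G center_W kernel_\<psi> kernel_\<chi> by simp_all

lemma incl_mon: "incl \<in> mon W G"
  using incl_hom incl_inj by (simp add: mon_def)

lemma incl_mem_center:
  assumes "w \<in> carrier W"
  shows "incl w \<in> generate G {z} \<longleftrightarrow> w \<in> generate W {c}"
proof
  assume "incl w \<in> generate G {z}"
  then show "w \<in> generate W {c}"
    using incl_eq_z_pow[OF assms] by (auto simp: G.generate_pow W.generate_pow)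
next
  assume "w \<in> generate W {c}"
  then obtain i :: int where "w = c [^]\<^bsub>W\<^esub> i" by (auto simp: W.generate_pow)
  then have "incl w = z [^]\<^bsub>G\<^esub> (int (n * m) * i)"
    using G.int_pow_pow[of z "int (n * m)" i] unfolding int_pow_int by (simp add: incl.hom_int_pow incl_c)
  then show "incl w \<in> generate G {z}" by (auto simp: G.generate_pow)
qed

lemma incl_mon_center:
  "incl \<in> mon (subgroup_generated W {c}) (subgroup_generated G {z})"
proof -
  have sub: "generate W {c} \<subseteq> carrier W" by (rule W.generate_incl) simp
  have "incl \<in> hom (subgroup_generated W {c}) (subgroup_generated G {z})"
    using sub incl_mem_center incl.hom_mult
    by (auto simp: hom_def G.carrier_subgroup_generated_singleton W.carrier_subgroup_generated_singleton subset_iff)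
  then show ?thesis
    using inj_on_subset[OF incl_inj sub] by (simp add: mon_def W.carrier_subgroup_generated_singleton)
qed

text \<open>The composite from \<open>W\<close> to \<open>G\<close> modulo its center is onto
  because \<open>G\<close> is the product of \<open>W\<close> and the powers of \<open>z\<close>.
  Its kernel is the part of \<open>W\<close> among these powers, which is the center of
  \<open>W\<close>.\<close>

lemma iso_center_quotients:
  "induced_map (\<lambda>x. center G #>\<^bsub>G\<^esub> incl x) \<in> iso (W Mod center W) (G Mod center G)"
proof -
  interpret Z: normal "center G" G
    by (rule G.subgroup_central_normal[OF G.center_subgroup]) simp
  interpret Mod: group "G Mod center G" by (rule Z.factorgroup_is_group)
  have "(\<lambda>x. center G #>\<^bsub>G\<^esub> incl x) \<in> hom W (G Mod center G)"
    using hom_compose[OF incl_hom Z.r_coset_hom_Mod] by (simp add: comp_def)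
  then interpret h: group_hom W "G Mod center G" "\<lambda>x. center G #>\<^bsub>G\<^esub> incl x"
    by unfold_locales
  have coset: "center G #>\<^bsub>G\<^esub> g = center G \<longleftrightarrow> g \<in> center G" if "g \<in> carrier G" for g
    using G.coset_join1 G.coset_join2 G.center_subgroup that by blast
  have "kernel W (G Mod center G) (\<lambda>x. center G #>\<^bsub>G\<^esub> incl x) = center W"
  proof -
    have "center G #>\<^bsub>G\<^esub> incl w = center G \<longleftrightarrow> w \<in> center W" if "w \<in> carrier W" for w
      using coset[OF incl.hom_closed[OF that]] incl_mem_center[OF that]
      unfolding center_W by (simp add: center_G)
    then have "kernel W (G Mod center G) (\<lambda>x. center G #>\<^bsub>G\<^esub> incl x) = {w \<in> carrier W. w \<in> center W}"
      unfolding kernel_def one_FactGroup by blast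
    also have "\<dots> = center W" by (auto simp: center_def)
    finally show ?thesis .
  qed
  moreover have "(\<lambda>x. center G #>\<^bsub>G\<^esub> incl x) ` carrier W = carrier (G Mod center G)"
  proof -
    have "center G #>\<^bsub>G\<^esub> g \<in> (\<lambda>x. center G #>\<^bsub>G\<^esub> incl x) ` carrier W" if "g \<in> carrier G" for g
    proof -
      obtain w i where w: "w \<in> carrier W" "g = incl w \<otimes>\<^bsub>G\<^esub> z [^]\<^bsub>G\<^esub> (i::int)" by (rule G_decomposition[OF \<open>g \<in> carrier G\<close>])
      have "g \<otimes>\<^bsub>G\<^esub> inv\<^bsub>G\<^esub> (incl w) = z [^]\<^bsub>G\<^esub> i"
        unfolding w(2) z_pow_commute[OF incl.hom_closed[OF w(1)], symmetric] using w(1)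
        by (simp add: G.m_assoc del: incl.hom_inv)
      then have "center G #>\<^bsub>G\<^esub> (g \<otimes>\<^bsub>G\<^esub> inv\<^bsub>G\<^esub> (incl w)) = center G"
        using coset G.center_int_pow[OF z_center] by simp
      then have "center G #>\<^bsub>G\<^esub> g = center G #>\<^bsub>G\<^esub> incl w"
        using w(1) that by (intro G.coset_mult_inv1) (auto simp: Z.subset)
      then show ?thesis using w(1) by blast
    qed
    then show ?thesis using h.hom_closed by (auto simp: FactGroup_def RCOSETS_def)
  qed
  ultimately show ?thesis
    using h.FactGroup_iso_set unfolding induced_map_def by simp
qed

end

theorem theorem3p3:
  fixes k n m :: nat
  assumes "k \<ge> 2" and "n \<ge> 2" and "m \<ge> 2" and "n < m" and "coprime n m"
  shows
    "(induced_map (toric_to_alt k n m) \<in> iso (toric_quot k n m) (cox_alt k n m)) \<and>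
     (short_exact (subgroup_generated (J_group k n m) {J_stu k n m}) id
        (J_group k n m) (J_to_alt k n m) (cox_alt k n m)) \<and>
     (short_exact (subgroup_generated (toric_group k n m) {toric_c k n m}) id
        (toric_group k n m) (toric_to_alt k n m) (cox_alt k n m)) \<and>
     (toric_incl k n m \<in> mon (subgroup_generated (toric_group k n m) {toric_c k n m})
        (subgroup_generated (J_group k n m) {J_stu k n m})) \<and>
     (toric_incl k n m \<in> mon (toric_group k n m) (J_group k n m)) \<and>
     (\<forall>z\<in>carrier (subgroup_generated (toric_group k n m) {toric_c k n m}).
        toric_incl k n m (id z) = id (toric_incl k n m z)) \<and>
     (\<forall>x\<in>carrier (toric_group k n m).
        id (toric_to_alt k n m x) = J_to_alt k n m (toric_incl k n m x)) \<and>
     (center (toric_group k n m) = generate (toric_group k n m) {toric_c k n m}) \<and>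
     (center (J_group k n m) = generate (J_group k n m) {J_stu k n m}) \<and>
     (induced_map (\<lambda>x. center (J_group k n m) #>\<^bsub>J_group k n m\<^esub> toric_incl k n m x)
        \<in> iso (toric_group k n m Mod center (toric_group k n m))
        (J_group k n m Mod center (J_group k n m))) \<and>
     (toric_group k n m Mod center (toric_group k n m) = toric_quot k n m) \<and>
     (induced_map (J_to_alt k n m)
        \<in> iso (J_group k n m Mod center (J_group k n m)) (cox_alt k n m)) \<and>
     (induced_map (toric_to_alt k n m)
        \<in> iso (toric_group k n m Mod center (toric_group k n m)) (cox_alt k n m))"
proof -
  interpret toric_triangle k n m
    using assms by unfold_locales auto
  have "short_exact (subgroup_generated G {z}) id G \<psi> Alt"
    by (rule short_exactI[OF \<psi>.group_hom_axioms \<psi>_surj z_closed kernel_\<psi>])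
  moreover have "short_exact (subgroup_generated W {c}) id W \<chi> Alt"
    by (rule short_exactI[OF \<chi>.group_hom_axioms \<chi>_surj c_closed kernel_\<chi>])
  moreover have "induced_map \<chi> \<in> iso (toric_quot k n m) Alt" "W Mod center W = toric_quot k n m"
    using iso_Alt(2) by (simp_all only: toric_quot_eq)
  moreover have "\<forall>x\<in>carrier W. id (\<chi> x) = \<psi> (incl x)" "\<forall>z\<in>carrier (subgroup_generated W {c}). incl (id z) = id (incl z)"
    by (simp_all add: \<chi>_eq)
  ultimately show ?thesis
    using iso_Alt incl_mon incl_mon_center iso_center_quotients center_W center_G by blast
qed

end
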